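(* Let $k\ge 3$ and let $N_k=\mathrm{span}\{I_k,E,E^2,\dots,E^{k-2},e_{12},e_{13},\dots,e_{1k}\}\subseteq UT_k(F)$, where $E=\sum_{i=1}^{k-1}e_{i,i+1}$ and $I_k$ is the identity matrix, regarded as a superalgebra with the trivial grading. Then $$C^{gr}(N_k)=\mathrm{Id}^{gr}(N_{k-1})=\langle [y_1,\dots,y_{k-1}],\ [y_1,y_2][y_3,y_4],\ z\rangle_{T_2}.$$
   Context: $F$ is a field of characteristic zero; $UT_k(F)$ is the algebra of upper triangular $k\times k$ matrices with matrix units $e_{ij}$. A superalgebra is an algebra $A=A_0\oplus A_1$ with $A_iA_j\subseteq A_{i+j\bmod 2}$ (trivial grading: $A_1=0$); $Z(A)$ is the center. $F\langle Y,Z\rangle$ is the free associative algebra on disjoint countable sets $Y=\{y_1,y_2,\dots\}$ (even variables) and $Z=\{z_1,z_2,\dots\}$ (odd variables); $z$ denotes an odd variable. $\mathrm{Id}^{gr}(A)$ is the set of graded identities of $A$ (polynomials vanishing under all substitutions of even variables by elements of $A_0$ and odd ones by elements of $A_1$); $C^{gr}(A)$ is the set of central graded polynomials (zero constant term and all such evaluations lie in $Z(A)$). $\langle S\rangle_{T_2}$ is the smallest ideal of $F\langle Y,Z\rangle$ containing $S$ and invariant under all grading-preserving endomorphisms. Commutators are left-normed: $[a,b]=ab-ba$, $[a_1,\dots,a_m]=[[a_1,\dots,a_{m-1}],a_m]$. *)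

theory Defs
  imports "HOL-Library.Poly_Mapping" "Jordan_Normal_Form.Matrix"
begin

text \<open>Variables: Yv i are the even variables y_i, Zv i the odd variables z_i.
  A noncommutative polynomial is a finitely supported map from words (monomials)
  to coefficients.\<close>

datatype var = Yv nat | Zv nat

type_synonym 'a ncpoly = "var list \<Rightarrow>\<^sub>0 'a"

definition ncvar :: "var \<Rightarrow> 'a::{zero,one} ncpoly" where
  "ncvar v = Poly_Mapping.single [v] 1"

definition ncmul :: "'a::semiring_0 ncpoly \<Rightarrow> 'a ncpoly \<Rightarrow> 'a ncpoly" where
  "ncmul p q = (\<Sum>u\<in>Poly_Mapping.keys p. \<Sum>w\<in>Poly_Mapping.keys q.
      Poly_Mapping.single (u @ w) (Poly_Mapping.lookup p u * Poly_Mapping.lookup q w))"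

definition ncsmult :: "'a::semiring_0 \<Rightarrow> 'a ncpoly \<Rightarrow> 'a ncpoly" where
  "ncsmult c p = Poly_Mapping.map (\<lambda>x. c * x) p"

definition nccomm :: "'a::ring ncpoly \<Rightarrow> 'a ncpoly \<Rightarrow> 'a ncpoly" where
  "nccomm p q = ncmul p q - ncmul q p"

definition nccomms :: "'a::ring ncpoly \<Rightarrow> 'a ncpoly list \<Rightarrow> 'a ncpoly" where
  "nccomms p ps = foldl nccomm p ps"

definition ncword :: "(var \<Rightarrow> 'a::semiring_1 ncpoly) \<Rightarrow> var list \<Rightarrow> 'a ncpoly" where
  "ncword \<sigma> w = foldr (\<lambda>v acc. ncmul (\<sigma> v) acc) w (Poly_Mapping.single [] 1)"

definition ncsubst :: "(var \<Rightarrow> 'a::semiring_1 ncpoly) \<Rightarrow> 'a ncpoly \<Rightarrow> 'a ncpoly" where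
  "ncsubst \<sigma> p = (\<Sum>w\<in>Poly_Mapping.keys p. ncsmult (Poly_Mapping.lookup p w) (ncword \<sigma> w))"

definition is_odd_var :: "var \<Rightarrow> bool" where
  "is_odd_var v = (case v of Yv _ \<Rightarrow> False | Zv _ \<Rightarrow> True)"

definition word_odd :: "var list \<Rightarrow> bool" where
  "word_odd w = odd (length (filter is_odd_var w))"

definition homog_even :: "'a::zero ncpoly \<Rightarrow> bool" where
  "homog_even p = (\<forall>w\<in>Poly_Mapping.keys p. \<not> word_odd w)"

definition homog_odd :: "'a::zero ncpoly \<Rightarrow> bool" where
  "homog_odd p = (\<forall>w\<in>Poly_Mapping.keys p. word_odd w)"

text \<open>Grading-preserving endomorphisms of F<Y,Z> are exactly the substitutions
  sending even variables to even elements and odd variables to odd elements.\<close>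
definition graded_subst :: "(var \<Rightarrow> 'a::zero ncpoly) \<Rightarrow> bool" where
  "graded_subst \<sigma> = (\<forall>i. homog_even (\<sigma> (Yv i)) \<and> homog_odd (\<sigma> (Zv i)))"

inductive_set T2_ideal :: "'a::field ncpoly set \<Rightarrow> 'a ncpoly set" for S where
  gen: "p \<in> S \<Longrightarrow> p \<in> T2_ideal S"
| zero: "0 \<in> T2_ideal S"
| add: "p \<in> T2_ideal S \<Longrightarrow> q \<in> T2_ideal S \<Longrightarrow> p + q \<in> T2_ideal S"
| smult: "p \<in> T2_ideal S \<Longrightarrow> ncsmult c p \<in> T2_ideal S"
| mult_left: "p \<in> T2_ideal S \<Longrightarrow> ncmul q p \<in> T2_ideal S"
| mult_right: "p \<in> T2_ideal S \<Longrightarrow> ncmul p q \<in> T2_ideal S"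
| subst: "p \<in> T2_ideal S \<Longrightarrow> graded_subst \<sigma> \<Longrightarrow> ncsubst \<sigma> p \<in> T2_ideal S"

definition mat_word :: "nat \<Rightarrow> (var \<Rightarrow> 'a::semiring_1 mat) \<Rightarrow> var list \<Rightarrow> 'a mat" where
  "mat_word n \<phi> w = foldr (\<lambda>v acc. \<phi> v * acc) w (1\<^sub>m n)"

definition ncevalm :: "nat \<Rightarrow> (var \<Rightarrow> 'a::semiring_1 mat) \<Rightarrow> 'a ncpoly \<Rightarrow> 'a mat" where
  "ncevalm n \<phi> p = mat n n (\<lambda>(i,j). \<Sum>w\<in>Poly_Mapping.keys p. Poly_Mapping.lookup p w * mat_word n \<phi> w $$ (i,j))"

text \<open>A subalgebra A of the n x n matrices regarded as a superalgebra with trivial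
  grading: A_0 = A, A_1 = 0. Admissible (graded) evaluations send even variables
  into A and odd variables to 0.\<close>
definition triv_graded_eval :: "'a::semiring_1 mat set \<Rightarrow> nat \<Rightarrow> (var \<Rightarrow> 'a mat) \<Rightarrow> bool" where
  "triv_graded_eval A n \<phi> = (\<forall>i. \<phi> (Yv i) \<in> A \<and> \<phi> (Zv i) = 0\<^sub>m n n)"

definition center_of :: "'a::semiring_0 mat set \<Rightarrow> 'a mat set" where
  "center_of A = {a \<in> A. \<forall>b\<in>A. a * b = b * a}"

definition Id_gr :: "'a::semiring_1 mat set \<Rightarrow> nat \<Rightarrow> 'a ncpoly set" where
  "Id_gr A n = {p. \<forall>\<phi>. triv_graded_eval A n \<phi> \<longrightarrow> ncevalm n \<phi> p = 0\<^sub>m n n}"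

definition C_gr :: "'a::semiring_1 mat set \<Rightarrow> nat \<Rightarrow> 'a ncpoly set" where
  "C_gr A n = {p. Poly_Mapping.lookup p [] = 0 \<and>
      (\<forall>\<phi>. triv_graded_eval A n \<phi> \<longrightarrow> ncevalm n \<phi> p \<in> center_of A)}"

text \<open>Matrix units with 0-based indices: unit_mat k i j = e_{i+1,j+1}.\<close>
definition unit_mat :: "nat \<Rightarrow> nat \<Rightarrow> nat \<Rightarrow> 'a::{zero,one} mat" where
  "unit_mat k i j = mat k k (\<lambda>(r,s). if r = i \<and> s = j then 1 else 0)"

definition shift_mat :: "nat \<Rightarrow> 'a::{zero,one} mat" where
  "shift_mat k = mat k k (\<lambda>(r,s). if s = r + 1 then 1 else 0)"

definition N_alg :: "nat \<Rightarrow> 'a::field mat set" where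
  "N_alg k = {A. \<exists>c d. A = mat k k (\<lambda>(r,s).
      (\<Sum>m<k - 1. c m * (shift_mat k ^\<^sub>m m) $$ (r,s)) +
      (\<Sum>j\<in>{1..<k}. d j * unit_mat k 0 j $$ (r,s)))}"

end

theory Submission
  imports Defs
begin

text \<open>Write an element of N_n as a pair (p, r): the rows below the first are the Toeplitz matrix of
  p in F[t]/(t^{n-1}), and the rest of the first row is r in F[t]/(t^{n-1}). The product is
  (p, r)(q, s) = (pq, p(0) s + r q), so a commutator is (0, r(q - q(0)) - s(p - p(0))) and commuting
  with (q, s) multiplies (0, r) by q - q(0), a multiple of t. Hence the generators evaluate in N_n to
  first rows supported in columns > k - 1 (1-based): these are zero for n = k - 1 and the
  central multiples of e_{1k} for n = k.

  Conversely let f vanish in the columns 2, ..., k - 1 of the first row under all evaluations in N_n,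
  with zero commutative image. Modulo the T-ideal, f is a combination of u [y_i, y_j, s] with words u, s
  in which letters may be permuted. At y_i = (a_i + b_i t, r_i) such a term has the value
  a^u (r_i b_j - r_j b_i) b^s in the column determined by the length of s. This is the Koszul
  differential of e_i \<and> e_j \<otimes> s; by the Jacobi identity the Koszul contracting homotopy (dividing by
  degrees, which needs characteristic zero) recovers f modulo the T-ideal from these values, which are
  coefficients of a vanishing polynomial function and so vanish by independence of characters.\<close>

text \<open>With concatenation as addition of exponents, convolution of finitely supported maps is
  the product of the free algebra, so \<open>ncpoly\<close> inherits a ring structure in which
  \<open>ncmul\<close> is the ring product.\<close>

instantiation list :: (type) monoid_add
begin
definition "0 = []"
definition "xs + ys = xs @ ys"
instance by standard (auto simp: zero_list_def plus_list_def)
end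

subsection \<open>The free algebra as a ring\<close>

abbreviation mon :: "'b \<Rightarrow> 'a::zero \<Rightarrow> 'b \<Rightarrow>\<^sub>0 'a" where
  "mon \<equiv> Poly_Mapping.single"

lemma mon_mult: "mon u a * mon w b = mon (u @ w) (a * b :: 'a::semiring_0)"
  by (simp add: mult_single plus_list_def)

lemma mon_Nil_1: "mon [] 1 = 1"
  by (metis single_one zero_list_def)

lemma sum_mon_keys: "(\<Sum>w\<in>Poly_Mapping.keys p. mon w (Poly_Mapping.lookup p w)) = p"
  by (rule poly_mapping_eqI) (auto simp: lookup_sum lookup_single when_def in_keys_iff)

lemma poly_mapping_additive_induct [case_names mon add]:
  assumes "\<And>w c. P (mon w c)" and "\<And>p q. P p \<Longrightarrow> P q \<Longrightarrow> P (p + q)"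
  shows "P (p :: 'b \<Rightarrow>\<^sub>0 'a::comm_monoid_add)"
proof -
  have "P (\<Sum>w\<in>S. mon w (Poly_Mapping.lookup p w))" if "finite S" for S
    using that
  proof (induction S rule: finite_induct)
    case empty
    then show ?case using assms(1)[of undefined 0] by simp
  next
    case (insert x F)
    then show ?case using assms by simp
  qed
  from this[of "Poly_Mapping.keys p"] show ?thesis by (simp add: sum_mon_keys)
qed

text \<open>Cancellation may shrink the support of a sum, so all three sums are extended to the
  union of the supports, where the extra terms are zero. Additivity of substitution, evaluation and
  the homotopy all follow from this.\<close>

lemma sum_keys_add:
  fixes p q :: "'b \<Rightarrow>\<^sub>0 'a::comm_monoid_add" and h :: "'b \<Rightarrow> 'a \<Rightarrow> 'c::comm_monoid_add"
  assumes "\<And>k. h k 0 = 0" and "\<And>k x y. h k (x + y) = h k x + h k y"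
  shows "(\<Sum>k\<in>Poly_Mapping.keys (p + q). h k (Poly_Mapping.lookup (p + q) k)) =
    (\<Sum>k\<in>Poly_Mapping.keys p. h k (Poly_Mapping.lookup p k)) +
    (\<Sum>k\<in>Poly_Mapping.keys q. h k (Poly_Mapping.lookup q k))"
proof -
  let ?S = "Poly_Mapping.keys p \<union> Poly_Mapping.keys q"
  have *: "(\<Sum>k\<in>Poly_Mapping.keys r. h k (Poly_Mapping.lookup r k)) = (\<Sum>k\<in>?S. h k (Poly_Mapping.lookup r k))"
    if "Poly_Mapping.keys r \<subseteq> ?S" for r
    by (rule sum.mono_neutral_left) (use that assms in \<open>auto simp: in_keys_iff\<close>)
  show ?thesis
    by (subst (1 2 3) *) (auto simp: lookup_add assms sum.distrib dest: Poly_Mapping.keys_add[THEN subsetD])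
qed

lemma ncmul_eq: "ncmul p q = p * q"
proof -
  have "p * q = (\<Sum>u\<in>Poly_Mapping.keys p. mon u (Poly_Mapping.lookup p u)) *
      (\<Sum>u\<in>Poly_Mapping.keys q. mon u (Poly_Mapping.lookup q u))"
    by (simp add: sum_mon_keys)
  also have "\<dots> = ncmul p q"
    by (simp add: ncmul_def sum_product mon_mult)
  finally show ?thesis by simp
qed

lemma ncsmult_eq: "ncsmult c p = mon [] c * p"
  unfolding ncsmult_def zero_list_def[symmetric] by (rule mult_map_scale_conv_mult)

lemma nccomm_eq: "nccomm p q = p * q - q * p"
  by (simp add: nccomm_def ncmul_eq)

lemma scalar_commute: "mon [] c * p = p * (mon [] c :: 'a::comm_ring_1 ncpoly)"
  by (induction p rule: poly_mapping_additive_induct)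
    (simp_all add: mon_mult mult.commute distrib_left distrib_right)

lemma scalar_left_commute: "p * (mon [] c * q) = mon [] c * (p * (q :: 'a::comm_ring_1 ncpoly))"
  by (metis scalar_commute mult.assoc)

lemma ncword_Nil: "ncword \<sigma> [] = 1"
  by (simp add: ncword_def mon_Nil_1)

lemma ncword_Cons: "ncword \<sigma> (v # w) = \<sigma> v * ncword \<sigma> w"
  by (simp add: ncword_def ncmul_eq)

lemma ncword_append: "ncword \<sigma> (u @ w) = ncword \<sigma> u * ncword \<sigma> w"
  by (induction u) (simp_all add: ncword_Nil ncword_Cons mult.assoc)

lemma ncsubst_add: "ncsubst \<sigma> (p + q) = ncsubst \<sigma> p + ncsubst \<sigma> q"
  unfolding ncsubst_def ncsmult_eq
  by (rule sum_keys_add) (simp_all add: single_add distrib_right)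

lemma ncsubst_mon: "ncsubst \<sigma> (mon w c) = mon [] c * ncword \<sigma> w"
  by (simp add: ncsubst_def ncsmult_eq)

lemma ncsubst_ncvar: "ncsubst \<sigma> (ncvar v) = \<sigma> v"
  by (simp add: ncvar_def ncsubst_mon ncword_Nil ncword_Cons mon_Nil_1)

lemma ncsubst_mult: "ncsubst \<sigma> (p * q) = ncsubst \<sigma> p * ncsubst \<sigma> (q :: 'a::comm_ring_1 ncpoly)"
proof (induction p rule: poly_mapping_additive_induct)
  case (mon u a)
  show ?case
  proof (induction q rule: poly_mapping_additive_induct)
    case (mon w b)
    have "ncsubst \<sigma> (mon u a) * ncsubst \<sigma> (mon w b)
        = mon [] a * (ncword \<sigma> u * (mon [] b * ncword \<sigma> w))"
      by (simp add: ncsubst_mon mult.assoc)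
    also have "\<dots> = (mon [] a * mon [] b) * (ncword \<sigma> u * ncword \<sigma> w)"
      by (metis scalar_left_commute mult.assoc)
    finally show ?case
      by (simp add: mon_mult ncsubst_mon ncword_append)
  qed (simp add: distrib_left ncsubst_add)
qed (simp add: distrib_right ncsubst_add)

lemma ncsubst_diff: "ncsubst \<sigma> (p - q) = ncsubst \<sigma> p - ncsubst \<sigma> (q :: 'a::comm_ring_1 ncpoly)"
  by (metis add_diff_cancel diff_add_cancel ncsubst_add)

lemma ncsubst_nccomm:
  "ncsubst \<sigma> (nccomm p q) = nccomm (ncsubst \<sigma> p) (ncsubst \<sigma> (q :: 'a::comm_ring_1 ncpoly))"
  by (simp add: nccomm_eq ncsubst_diff ncsubst_mult)

lemma nccomms_Nil: "nccomms p [] = p"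
  by (simp add: nccomms_def)

lemma nccomms_Cons: "nccomms p (q # qs) = nccomms (nccomm p q) qs"
  by (simp add: nccomms_def)

lemma nccomms_append: "nccomms p (qs @ rs) = nccomms (nccomms p qs) rs"
  by (simp add: nccomms_def)

lemma ncsubst_nccomms:
  "ncsubst \<sigma> (nccomms p qs) = nccomms (ncsubst \<sigma> p) (map (ncsubst \<sigma>) (qs :: 'a::comm_ring_1 ncpoly list))"
  by (induction qs arbitrary: p) (simp_all add: nccomms_Nil nccomms_Cons ncsubst_nccomm)

subsection \<open>Evaluation in matrices\<close>

lemma mat_word_carrier:
  assumes "\<forall>v. \<phi> v \<in> carrier_mat n n"
  shows "mat_word n \<phi> w \<in> carrier_mat n n"
  by (induction w) (auto simp: mat_word_def intro!: mult_carrier_mat[of _ _ n] assms[rule_format])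

lemma mat_word_Nil: "mat_word n \<phi> [] = 1\<^sub>m n"
  by (simp add: mat_word_def)

lemma mat_word_Cons: "mat_word n \<phi> (v # w) = \<phi> v * mat_word n \<phi> w"
  by (simp add: mat_word_def)

lemma mat_word_append:
  assumes "\<forall>v. \<phi> v \<in> carrier_mat n n"
  shows "mat_word n \<phi> (u @ w) = mat_word n \<phi> u * mat_word n \<phi> w"
proof (induction u)
  case Nil
  show ?case using left_mult_one_mat[OF mat_word_carrier[OF assms]] by (simp add: mat_word_Nil)
next
  case (Cons v u)
  then show ?case using mat_word_carrier[OF assms] assms
    by (simp add: mat_word_Cons assoc_mult_mat[of _ n n _ n _ n])
qed

lemma ncevalm_carrier: "ncevalm n \<phi> p \<in> carrier_mat n n"
  by (simp add: ncevalm_def)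

lemma ncevalm_dim [simp]: "dim_row (ncevalm n \<phi> p) = n" "dim_col (ncevalm n \<phi> p) = n"
  by (simp_all add: ncevalm_def)

lemma ncevalm_index:
  assumes "i < n" "j < n"
  shows "ncevalm n \<phi> p $$ (i, j) =
    (\<Sum>w\<in>Poly_Mapping.keys p. Poly_Mapping.lookup p w * mat_word n \<phi> w $$ (i, j))"
  using assms by (simp add: ncevalm_def)

lemma ncevalm_add: "ncevalm n \<phi> (p + q) = ncevalm n \<phi> p + ncevalm n \<phi> q"
  by (rule eq_matI) (auto simp: ncevalm_index distrib_right intro!: sum_keys_add)

lemma ncevalm_mon:
  assumes "\<forall>v. \<phi> v \<in> carrier_mat n n"
  shows "ncevalm n \<phi> (mon w c) = c \<cdot>\<^sub>m mat_word n \<phi> w"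
  using mat_word_carrier[OF assms, of w] by (intro eq_matI) (auto simp: ncevalm_index)

lemma ncevalm_ncvar:
  assumes "\<forall>v. \<phi> v \<in> carrier_mat n n"
  shows "ncevalm n \<phi> (ncvar v) = \<phi> v"
  using assms by (intro eq_matI)
    (auto simp: ncvar_def ncevalm_mon[OF assms] mat_word_Cons mat_word_Nil right_mult_one_mat[OF assms[rule_format]])

lemma ncevalm_mult:
  fixes p q :: "'a::comm_ring_1 ncpoly"
  assumes "\<forall>v. \<phi> v \<in> carrier_mat n n"
  shows "ncevalm n \<phi> (p * q) = ncevalm n \<phi> p * ncevalm n \<phi> q"
proof (induction p rule: poly_mapping_additive_induct)
  case (mon u a)
  show ?case
  proof (induction q rule: poly_mapping_additive_induct)
    case (mon w b)
    have u: "mat_word n \<phi> u \<in> carrier_mat n n" and w: "mat_word n \<phi> w \<in> carrier_mat n n"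
      using mat_word_carrier[OF assms] by auto
    show ?case
      using u w
      by (simp add: mon_mult ncevalm_mon[OF assms] mat_word_append[OF assms]
          mult_smult_assoc_mat[OF u, of "b \<cdot>\<^sub>m mat_word n \<phi> w"]  mult_smult_distrib[OF u w])
        (auto intro!: eq_matI)
  next
    case (add p q)
    then show ?case
      by (simp add: distrib_left ncevalm_add mult_add_distrib_mat[OF ncevalm_carrier ncevalm_carrier ncevalm_carrier])
  qed
next
  case (add p q')
  then show ?case
    by (simp add: distrib_right ncevalm_add add_mult_distrib_mat[OF ncevalm_carrier ncevalm_carrier ncevalm_carrier])
qed

lemma ncevalm_scalar:
  fixes p :: "'a::comm_ring_1 ncpoly"
  assumes "\<forall>v. \<phi> v \<in> carrier_mat n n"
  shows "ncevalm n \<phi> (mon [] c * p) = c \<cdot>\<^sub>m ncevalm n \<phi> p"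
  by (simp add: ncevalm_mult[OF assms] ncevalm_mon[OF assms] mat_word_Nil
      mult_smult_assoc_mat[OF one_carrier_mat ncevalm_carrier] left_mult_one_mat[OF ncevalm_carrier])

lemma ncevalm_diff:
  fixes p q :: "'a::ring_1 ncpoly"
  shows "ncevalm n \<phi> (p - q) = ncevalm n \<phi> p - ncevalm n \<phi> q"
proof -
  have "ncevalm n \<phi> p = ncevalm n \<phi> (p - q) + ncevalm n \<phi> q"
    by (simp flip: ncevalm_add)
  then show ?thesis by (intro eq_matI) auto
qed

lemma ncevalm_0: "ncevalm n \<phi> 0 = 0\<^sub>m n n"
  by (rule eq_matI) (auto simp: ncevalm_index)

text \<open>Turns invariance under substitution into a change of the evaluation.\<close>

lemma ncevalm_ncsubst:
  fixes p :: "'a::comm_ring_1 ncpoly"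
  assumes "\<forall>v. \<phi> v \<in> carrier_mat n n"
  shows "ncevalm n \<phi> (ncsubst \<sigma> p) = ncevalm n (\<lambda>v. ncevalm n \<phi> (\<sigma> v)) p"
proof (induction p rule: poly_mapping_additive_induct)
  case (mon w c)
  have "ncevalm n \<phi> (ncword \<sigma> w) = mat_word n (\<lambda>v. ncevalm n \<phi> (\<sigma> v)) w"
  proof (induction w)
    case Nil
    then show ?case using ncevalm_mon[OF assms, of "[]" 1]
      by (auto simp: ncword_Nil mat_word_Nil mon_Nil_1 intro!: eq_matI)
  qed (simp add: ncword_Cons mat_word_Cons ncevalm_mult[OF assms])
  then show ?case
    by (simp add: ncsubst_mon ncevalm_scalar[OF assms] ncevalm_mon ncevalm_carrier)
qed (simp add: ncevalm_add ncsubst_add)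

subsection \<open>The algebras N_k\<close>

lemma index_mult_mat_sum:
  assumes "A \<in> carrier_mat n n" "B \<in> carrier_mat n n" "i < n" "j < n"
  shows "(A * B) $$ (i, j) = (\<Sum>l<n. A $$ (i, l) * B $$ (l, j))"
  using assms by (simp add: scalar_prod_def lessThan_atLeast0)

text \<open>\<open>r\<close> is the whole first row right of the diagonal, not the list of
  coefficients of the e_{1j}. With 0-based columns, \<open>r j\<close> is the coefficient of t^{j-1}
  in the second component of the pair.\<close>

definition Nmat :: "nat \<Rightarrow> (nat \<Rightarrow> 'a::zero) \<Rightarrow> (nat \<Rightarrow> 'a) \<Rightarrow> 'a mat" where
  "Nmat n r p = mat n n (\<lambda>(i, j). if i = 0 \<and> 0 < j then r j else if i \<le> j then p (j - i) else 0)"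

lemma Nmat_carrier [simp]: "Nmat n r p \<in> carrier_mat n n"
  by (simp add: Nmat_def)

lemma Nmat_dim [simp]: "dim_row (Nmat n r p) = n" "dim_col (Nmat n r p) = n"
  by (simp_all add: Nmat_def)

lemma Nmat_index:
  "i < n \<Longrightarrow> j < n \<Longrightarrow>
    Nmat n r p $$ (i, j) = (if i = 0 \<and> 0 < j then r j else if i \<le> j then p (j - i) else 0)"
  by (simp add: Nmat_def)

lemma shift_mat_pow_index:
  "i < n \<Longrightarrow> j < n \<Longrightarrow>
    ((shift_mat n :: 'a::semiring_1 mat) ^\<^sub>m d) $$ (i, j) = (if j = i + d then 1 else 0)"
proof (induction d arbitrary: j)
  case 0
  then show ?case by (auto simp: shift_mat_def)
next
  case (Suc d)
  have c: "(shift_mat n :: 'a mat) \<in> carrier_mat n n" by (simp add: shift_mat_def)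
  have "((shift_mat n :: 'a mat) ^\<^sub>m Suc d) $$ (i, j) =
      (\<Sum>l<n. (shift_mat n ^\<^sub>m d) $$ (i, l) * shift_mat n $$ (l, j))"
    using index_mult_mat_sum[OF pow_carrier_mat[OF c] c, of i j d] Suc.prems by simp
  also have "\<dots> = (\<Sum>l<n. if l = i + d then (if j = Suc l then 1 else 0) else 0)"
    by (rule sum.cong) (use Suc in \<open>auto simp: shift_mat_def\<close>)
  finally show ?case using Suc.prems by auto
qed

text \<open>The e_{1j} make the first row right of the diagonal arbitrary; the rest stays Toeplitz.
  For n = 1 no power of E is available, not even the identity, hence
  \<open>2 \<le> n\<close>.\<close>

lemma N_alg_eq:
  assumes "2 \<le> n"
  shows "N_alg n = {Nmat n r p | r p. True}"
proof (intro equalityI subsetI)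
  have shift: "(\<Sum>m<n - 1. c m * (shift_mat n ^\<^sub>m m) $$ (i, j)) =
      (if i \<le> j \<and> j - i < n - 1 then c (j - i) else 0)" if "i < n" "j < n"
    for c :: "nat \<Rightarrow> 'a" and i j
  proof -
    have "(\<Sum>m<n - 1. c m * (shift_mat n ^\<^sub>m m) $$ (i, j)) =
        (\<Sum>m<n - 1. if m = j - i then (if i \<le> j then c m else 0) else 0)"
      by (rule sum.cong) (use that in \<open>auto simp: shift_mat_pow_index\<close>)
    then show ?thesis by simp
  qed
  have unit: "(\<Sum>l\<in>{1..<n}. d l * unit_mat n 0 l $$ (i, j)) = (if i = 0 \<and> 0 < j then d j else 0)"
    if "i < n" "j < n" for d :: "nat \<Rightarrow> 'a" and i j
  proof -
    have "(\<Sum>l\<in>{1..<n}. d l * unit_mat n 0 l $$ (i, j)) =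
        (\<Sum>l\<in>{1..<n}. if l = j then (if i = 0 then d l else 0) else 0)"
      by (rule sum.cong) (use that in \<open>auto simp: unit_mat_def\<close>)
    then show ?thesis using that by auto
  qed
  fix A :: "'a mat"
  {
    assume "A \<in> N_alg n"
    then obtain c d where A: "A = mat n n (\<lambda>(r, s).
        (\<Sum>m<n - 1. c m * (shift_mat n ^\<^sub>m m) $$ (r, s)) +
        (\<Sum>j\<in>{1..<n}. d j * unit_mat n 0 j $$ (r, s)))"
      by (auto simp: N_alg_def)
    have "A = Nmat n (\<lambda>j. (if j < n - 1 then c j else 0) + d j) c"
      by (rule eq_matI) (use assms in \<open>auto simp: A Nmat_index shift unit simp del: One_nat_def\<close>)
    then show "A \<in> {Nmat n r p | r p. True}" by blast
  }
  {
    assume "A \<in> {Nmat n r p | r p. True}"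
    then obtain r p where A: "A = Nmat n r p" by blast
    \<comment> \<open>The contribution of the powers of E to column j is subtracted. E^{n-1} is not
      among them, so the last column needs no correction.\<close>
    have "A = mat n n (\<lambda>(i, s).
        (\<Sum>m<n - 1. p m * (shift_mat n ^\<^sub>m m) $$ (i, s)) +
        (\<Sum>j\<in>{1..<n}. (r j - (if j < n - 1 then p j else 0)) * unit_mat n 0 j $$ (i, s)))"
      by (rule eq_matI) (use assms in \<open>auto simp: A Nmat_index shift unit simp del: One_nat_def\<close>)
    then show "A \<in> N_alg n" unfolding N_alg_def by (intro CollectI exI)
  }
qed

lemma N_alg_carrier: "A \<in> N_alg n \<Longrightarrow> A \<in> carrier_mat n n"
  by (auto simp: N_alg_def)

text \<open>No nonzero term of such an entry involves the free part of a first row, so the entry is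
  a convolution of the Toeplitz parts.\<close>

lemma Nmat_mult_index:
  fixes p q :: "nat \<Rightarrow> 'a::comm_ring_1"
  assumes "0 < i \<or> j = 0" "i < n" "j < n"
  shows "(Nmat n r p * Nmat n s q) $$ (i, j) = (if i \<le> j then \<Sum>t\<le>j - i. p t * q (j - i - t) else 0)"
proof -
  have "(Nmat n r p * Nmat n s q) $$ (i, j) =
      (\<Sum>l<n. if i \<le> l \<and> l \<le> j then p (l - i) * q (j - l) else 0)"
    by (subst index_mult_mat_sum[OF Nmat_carrier Nmat_carrier])
      (use assms in \<open>auto simp: Nmat_index intro!: sum.cong\<close>)
  also have "\<dots> = (\<Sum>l\<in>{i..j}. p (l - i) * q (j - l))"
    by (rule sum.mono_neutral_cong_right) (use assms in auto)
  also have "\<dots> = (if i \<le> j then \<Sum>t\<le>j - i. p t * q (j - i - t) else 0)"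
    by (auto intro!: sum.reindex_bij_witness[of _ "\<lambda>t. t + i" "\<lambda>l. l - i"])
  finally show ?thesis .
qed

lemma convolution_commute:
  "(\<Sum>t\<le>d. p t * q (d - t)) = (\<Sum>t\<le>d. q t * (p (d - t) :: 'a::comm_ring_1))" for d :: nat
  by (rule sum.reindex_bij_witness[of _ "\<lambda>t. d - t" "\<lambda>t. d - t"]) (auto simp: mult.commute)

lemma N_alg_one: "2 \<le> n \<Longrightarrow> 1\<^sub>m n \<in> N_alg n"
  by (auto simp: N_alg_eq Nmat_def intro!: exI[of _ "\<lambda>_. 0"] exI[of _ "\<lambda>d. if d = 0 then 1 else 0"] eq_matI)

lemma N_alg_zero: "2 \<le> n \<Longrightarrow> 0\<^sub>m n n \<in> N_alg n"
  by (auto simp: N_alg_eq Nmat_def intro!: exI[of _ "\<lambda>_. 0"] eq_matI)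

lemma N_alg_add:
  assumes "2 \<le> n" "A \<in> N_alg n" "B \<in> N_alg n"
  shows "A + B \<in> N_alg n"
proof -
  obtain r p s q where "A = Nmat n r p" "B = Nmat n s q"
    using assms by (auto simp: N_alg_eq)
  then have "A + B = Nmat n (\<lambda>j. r j + s j) (\<lambda>j. p j + q j)"
    by (intro eq_matI) (auto simp: Nmat_index)
  then show ?thesis using assms(1) by (auto simp: N_alg_eq)
qed

lemma N_alg_smult:
  assumes "2 \<le> n" "A \<in> N_alg n"
  shows "c \<cdot>\<^sub>m A \<in> N_alg n"
proof -
  obtain r p where "A = Nmat n r p"
    using assms by (auto simp: N_alg_eq)
  then have "c \<cdot>\<^sub>m A = Nmat n (\<lambda>j. c * r j) (\<lambda>j. c * p j)"
    by (intro eq_matI) (auto simp: Nmat_index)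
  then show ?thesis using assms(1) by (auto simp: N_alg_eq)
qed

lemma N_alg_mult:
  assumes "2 \<le> n" "A \<in> N_alg n" "B \<in> N_alg n"
  shows "A * B \<in> N_alg n"
proof -
  obtain r p s q where AB: "A = Nmat n r p" "B = Nmat n s q"
    using assms by (auto simp: N_alg_eq)
  \<comment> \<open>The first row is free and can be read off the product itself; only the remaining
    entries must be shown to be Toeplitz.\<close>
  have "A * B = Nmat n (\<lambda>j. (A * B) $$ (0, j)) (\<lambda>d. \<Sum>t\<le>d. p t * q (d - t))"
    unfolding AB
  proof (rule eq_matI)
    fix i j assume "i < dim_row (Nmat n (\<lambda>j. (Nmat n r p * Nmat n s q) $$ (0, j)) (\<lambda>d. \<Sum>t\<le>d. p t * q (d - t)))"
      "j < dim_col (Nmat n (\<lambda>j. (Nmat n r p * Nmat n s q) $$ (0, j)) (\<lambda>d. \<Sum>t\<le>d. p t * q (d - t)))"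
    then have ij: "i < n" "j < n" by auto
    show "(Nmat n r p * Nmat n s q) $$ (i, j) =
      Nmat n (\<lambda>j. (Nmat n r p * Nmat n s q) $$ (0, j)) (\<lambda>d. \<Sum>t\<le>d. p t * q (d - t)) $$ (i, j)"
      using Nmat_mult_index[of i j n r p s q] ij by (cases "i = 0 \<and> 0 < j") (auto simp: Nmat_index)
  qed auto
  then show ?thesis using assms(1) by (auto simp: N_alg_eq)
qed

lemma triv_graded_eval_carrier:
  assumes "triv_graded_eval (N_alg n) n \<phi>"
  shows "\<forall>v. \<phi> v \<in> carrier_mat n n"
proof
  fix v show "\<phi> v \<in> carrier_mat n n"
    using assms by (cases v) (auto simp: triv_graded_eval_def intro: N_alg_carrier)
qed

lemma ncevalm_N_alg:
  assumes "2 \<le> n" "triv_graded_eval (N_alg n) n \<phi>"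
  shows "ncevalm n \<phi> p \<in> N_alg n"
proof (induction p rule: poly_mapping_additive_induct)
  case (mon w c)
  have "\<phi> v \<in> N_alg n" for v
    using assms N_alg_zero[OF assms(1)] by (cases v) (auto simp: triv_graded_eval_def)
  then have "mat_word n \<phi> w \<in> N_alg n"
    by (induction w) (auto simp: mat_word_Nil mat_word_Cons intro!: N_alg_one N_alg_mult assms)
  then show ?case
    by (simp add: ncevalm_mon[OF triv_graded_eval_carrier[OF assms(2)]] N_alg_smult assms)
qed (simp add: ncevalm_add N_alg_add assms)

lemma mat_word_Zv:
  assumes "triv_graded_eval (N_alg n) n \<phi>" "Zv i \<in> set w"
  shows "mat_word n \<phi> w = 0\<^sub>m n n"
proof -
  note c = triv_graded_eval_carrier[OF assms(1)]
  obtain u v where w: "w = u @ [Zv i] @ v"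
    using assms(2) by (metis append_Cons append_Nil split_list)
  have "\<phi> (Zv i) = 0\<^sub>m n n" using assms(1) by (simp add: triv_graded_eval_def)
  then have "mat_word n \<phi> ([Zv i] @ v) = 0\<^sub>m n n"
    using mat_word_carrier[OF c, of v] by (simp add: mat_word_Cons)
  then show ?thesis using mat_word_carrier[OF c, of u]
    unfolding w by (subst mat_word_append[OF c]) simp
qed

text \<open>An odd word contains an odd variable, which is evaluated at 0. Hence an admissible
  evaluation composed with a graded substitution is again admissible.\<close>

lemma ncevalm_homog_odd:
  assumes "triv_graded_eval (N_alg n) n \<phi>" "homog_odd p"
  shows "ncevalm n \<phi> p = 0\<^sub>m n n"
proof -
  have "mat_word n \<phi> w = 0\<^sub>m n n" if "w \<in> Poly_Mapping.keys p" for w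
  proof -
    have "filter is_odd_var w \<noteq> []"
      using assms(2) that by (auto simp: homog_odd_def word_odd_def)
    then obtain v where "v \<in> set w" "is_odd_var v" by (metis filter_False)
    moreover from this obtain i where "v = Zv i" by (auto simp: is_odd_var_def split: var.splits)
    ultimately show ?thesis using mat_word_Zv[OF assms(1)] by blast
  qed
  then show ?thesis by (intro eq_matI) (auto simp: ncevalm_index)
qed

section \<open>The filtration by the ideals of pairs (0, r) with t^d dividing r\<close>

definition row_ideal :: "nat \<Rightarrow> nat \<Rightarrow> 'a::zero mat set" where
  "row_ideal n d = {M \<in> carrier_mat n n. \<forall>i<n. \<forall>j<n. 0 < i \<or> j \<le> d \<longrightarrow> M $$ (i, j) = 0}"

lemma row_ideal_carrier: "M \<in> row_ideal n d \<Longrightarrow> M \<in> carrier_mat n n"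
  by (simp add: row_ideal_def)

lemma row_idealD:
  "M \<in> row_ideal n d \<Longrightarrow> i < n \<Longrightarrow> j < n \<Longrightarrow> 0 < i \<or> j \<le> d \<Longrightarrow> M $$ (i, j) = 0"
  by (auto simp: row_ideal_def)

lemma row_ideal_zero: "0\<^sub>m n n \<in> row_ideal n d"
  by (simp add: row_ideal_def)

lemma row_ideal_add:
  "M \<in> row_ideal n d \<Longrightarrow> M' \<in> row_ideal n d \<Longrightarrow> M + M' \<in> row_ideal n (d :: nat)"
  for M :: "'a::monoid_add mat"
  by (auto simp: row_ideal_def)

lemma row_ideal_smult: "M \<in> row_ideal n d \<Longrightarrow> c \<cdot>\<^sub>m M \<in> row_ideal n (d :: nat)"
  for M :: "'a::semiring_0 mat"
  by (auto simp: row_ideal_def)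

lemma row_ideal_mult_right:
  assumes "2 \<le> n" "M \<in> row_ideal n d" "A \<in> N_alg n"
  shows "M * A \<in> row_ideal n d"
proof -
  obtain r p where A: "A = Nmat n r p" using assms by (auto simp: N_alg_eq)
  note M = row_ideal_carrier[OF assms(2)]
  have "(M * A) $$ (i, j) = 0" if "i < n" "j < n" "0 < i \<or> j \<le> d" for i j
    unfolding A using that
    by (subst index_mult_mat_sum[OF M Nmat_carrier])
      (auto intro!: sum.neutral simp: row_idealD[OF assms(2)] Nmat_index)
  then show ?thesis using M by (auto simp: row_ideal_def A)
qed

lemma row_ideal_mult_left:
  assumes "2 \<le> n" "M \<in> row_ideal n d" "A \<in> N_alg n"
  shows "A * M \<in> row_ideal n d"
proof -
  obtain r p where A: "A = Nmat n r p" using assms by (auto simp: N_alg_eq)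
  note M = row_ideal_carrier[OF assms(2)]
  have "(A * M) $$ (i, j) = 0" if "i < n" "j < n" "0 < i \<or> j \<le> d" for i j
    unfolding A using that
    by (subst index_mult_mat_sum[OF Nmat_carrier M])
      (auto intro!: sum.neutral simp: row_idealD[OF assms(2)] Nmat_index)
  then show ?thesis using M by (auto simp: row_ideal_def A)
qed

text \<open>In each term M(i,l) M'(l,j) the left factor vanishes for l = 0 (first column) and the
  right factor for l > 0 (below the first row).\<close>

lemma row_ideal_mult_row_ideal:
  fixes M M' :: "'a::semiring_0 mat"
  assumes "M \<in> row_ideal n d" "M' \<in> row_ideal n d'"
  shows "M * M' = 0\<^sub>m n n"
proof (rule eq_matI)
  note c = assms[THEN row_ideal_carrier]
  fix i j assume "i < dim_row (0\<^sub>m n n :: 'a mat)" "j < dim_col (0\<^sub>m n n :: 'a mat)"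
  then have ij: "i < n" "j < n" by auto
  have "M $$ (i, l) * M' $$ (l, j) = 0" if "l < n" for l
    using row_idealD[OF assms(1), of i l] row_idealD[OF assms(2), of l j] ij that by (cases "l = 0") auto
  then show "(M * M') $$ (i, j) = 0\<^sub>m n n $$ (i, j)"
    using ij by (subst index_mult_mat_sum[OF c]) (auto intro!: sum.neutral)
qed (use assms[THEN row_ideal_carrier] in auto)

text \<open>Toeplitz parts commute, so only the first row survives. Its entry in column 1 is p(0)
  s_1 + r_1 q(0), which is symmetric in the two factors and cancels as well.\<close>

lemma commutator_row_ideal_1:
  assumes "2 \<le> n" "A \<in> N_alg n" "B \<in> N_alg n"
  shows "A * B - B * A \<in> row_ideal n 1"
proof -
  obtain r p s q where AB: "A = Nmat n r p" "B = Nmat n s q"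
    using assms by (auto simp: N_alg_eq)
  have "(A * B - B * A) $$ (i, j) = 0" if ij: "i < n" "j < n" "0 < i \<or> j \<le> 1" for i j
  proof (cases "0 < i \<or> j = 0")
    case True
    then show ?thesis unfolding AB
      using ij convolution_commute[of p q "j - i"] by (simp add: Nmat_mult_index del: index_mult_mat(1))
  next
    case False
    then have [simp]: "i = 0" "j = 1" using ij by auto
    have *: "(Nmat n r p * Nmat n s q) $$ (0, 1) = p 0 * s 1 + r 1 * q 0" for r p s q :: "nat \<Rightarrow> 'a"
    proof -
      have "(Nmat n r p * Nmat n s q) $$ (0, 1) = (\<Sum>l<n. Nmat n r p $$ (0, l) * Nmat n s q $$ (l, 1))"
        using assms(1) by (subst index_mult_mat_sum[OF Nmat_carrier Nmat_carrier]) auto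
      also have "\<dots> = (\<Sum>l\<in>{0, 1}. Nmat n r p $$ (0, l) * Nmat n s q $$ (l, 1))"
        by (rule sum.mono_neutral_right) (use assms(1) in \<open>auto simp: Nmat_index\<close>)
      finally show ?thesis using assms(1) by (simp add: Nmat_index)
    qed
    show ?thesis unfolding AB using assms(1) * by (simp add: mult.commute del: index_mult_mat(1) One_nat_def)
  qed
  then show ?thesis by (auto simp: row_ideal_def AB)
qed

text \<open>In the lowest column that may be nonzero, both products multiply the entry of M by the
  diagonal value \<open>p 0\<close> of A, so the difference starts one column later.\<close>

lemma commutator_row_ideal_Suc:
  assumes "2 \<le> n" "M \<in> row_ideal n d" "A \<in> N_alg n"
  shows "M * A - A * M \<in> row_ideal n (Suc d)"
proof -
  obtain r p where A: "A = Nmat n r p" using assms by (auto simp: N_alg_eq)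
  note M = row_ideal_carrier[OF assms(2)]
  have I: "M * A \<in> row_ideal n d" "A * M \<in> row_ideal n d"
    using row_ideal_mult_left row_ideal_mult_right assms by auto
  have "(M * A - A * M) $$ (i, j) = 0" if ij: "i < n" "j < n" "0 < i \<or> j \<le> Suc d" for i j
  proof (cases "0 < i \<or> j \<le> d")
    case True
    then show ?thesis using I[THEN row_idealD, of i j] ij M A
      by (simp del: index_mult_mat(1))
  next
    case False
    then have [simp]: "i = 0" "j = Suc d" using ij by auto
    have "(M * A) $$ (0, j) = (\<Sum>l<n. if l = j then M $$ (0, j) * p 0 else 0)"
      unfolding A using ij
      by (subst index_mult_mat_sum[OF M Nmat_carrier], simp, simp, intro sum.cong)
        (auto simp: Nmat_index row_idealD[OF assms(2)])
    moreover have "(A * M) $$ (0, j) = (\<Sum>l<n. if l = 0 then p 0 * M $$ (0, j) else 0)"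
      unfolding A using ij
      by (subst index_mult_mat_sum[OF Nmat_carrier M], simp, simp, intro sum.cong)
        (auto simp: Nmat_index row_idealD[OF assms(2)])
    ultimately show ?thesis using ij M A by (simp add: mult.commute del: index_mult_mat(1))
  qed
  then show ?thesis using M by (auto simp: row_ideal_def A)
qed

lemma ncevalm_nccomm:
  fixes p q :: "'a::comm_ring_1 ncpoly"
  assumes "\<forall>v. \<phi> v \<in> carrier_mat n n"
  shows "ncevalm n \<phi> (nccomm p q) = ncevalm n \<phi> p * ncevalm n \<phi> q - ncevalm n \<phi> q * ncevalm n \<phi> p"
  by (simp add: nccomm_eq ncevalm_diff ncevalm_mult[OF assms])

lemma ncevalm_nccomms_row_ideal:
  assumes "2 \<le> n" "triv_graded_eval (N_alg n) n \<phi>" "ncevalm n \<phi> p \<in> row_ideal n d"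
  shows "ncevalm n \<phi> (nccomms p qs) \<in> row_ideal n (d + length qs)"
  using assms(3)
proof (induction qs arbitrary: p d)
  case Nil
  then show ?case by (simp add: nccomms_Nil)
next
  case (Cons q qs)
  have "ncevalm n \<phi> (nccomm p q) \<in> row_ideal n (Suc d)"
    using commutator_row_ideal_Suc[OF assms(1) Cons.prems ncevalm_N_alg[OF assms(1,2), of q]]
    by (simp add: ncevalm_nccomm[OF triv_graded_eval_carrier[OF assms(2)]])
  from Cons.IH[OF this] show ?case by (simp add: nccomms_Cons)
qed

text \<open>\<open>row_ideal\<close> absorbs products with elements of N_n, and a graded
  substitution only changes the admissible evaluation; so it suffices to check generators.\<close>

lemma T2_ideal_eval_row_ideal:
  assumes "2 \<le> n"
    and "\<And>p \<phi>. p \<in> S \<Longrightarrow> triv_graded_eval (N_alg n) n \<phi> \<Longrightarrow> ncevalm n \<phi> p \<in> row_ideal n d"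
    and "p \<in> T2_ideal S" "triv_graded_eval (N_alg n) n \<phi>"
  shows "ncevalm n \<phi> p \<in> row_ideal n d"
  using assms(3,4)
proof (induction p arbitrary: \<phi> rule: T2_ideal.induct)
  case (gen p)
  then show ?case using assms(2) by blast
next
  case zero
  then show ?case by (simp add: ncevalm_0 row_ideal_zero)
next
  case (add p q)
  then show ?case by (simp add: ncevalm_add row_ideal_add)
next
  case (smult p c)
  then show ?case
    by (simp add: ncsmult_eq ncevalm_scalar[OF triv_graded_eval_carrier] row_ideal_smult)
next
  case (mult_left p q)
  then show ?case
    by (simp add: ncmul_eq ncevalm_mult[OF triv_graded_eval_carrier] row_ideal_mult_left assms(1) ncevalm_N_alg)
next
  case (mult_right p q)
  then show ?case
    by (simp add: ncmul_eq ncevalm_mult[OF triv_graded_eval_carrier] row_ideal_mult_right assms(1) ncevalm_N_alg)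
next
  case (subst p \<sigma>)
  have "triv_graded_eval (N_alg n) n (\<lambda>v. ncevalm n \<phi> (\<sigma> v))"
    using subst.hyps(2) ncevalm_N_alg[OF assms(1) subst.prems] ncevalm_homog_odd[OF subst.prems]
    by (simp add: triv_graded_eval_def graded_subst_def)
  then show ?case
    using subst.IH by (simp add: ncevalm_ncsubst[OF triv_graded_eval_carrier[OF subst.prems]])
qed

definition N_gens :: "nat \<Rightarrow> 'a::field ncpoly set" where
  "N_gens k = {nccomms (ncvar (Yv 1)) (map (\<lambda>i. ncvar (Yv i)) [2..<k]),
                ncmul (nccomm (ncvar (Yv 1)) (ncvar (Yv 2))) (nccomm (ncvar (Yv 3)) (ncvar (Yv 4))),
                ncvar (Zv 1)}"

text \<open>The first bracket lies in \<open>row_ideal n 1\<close> and each of the k - 3 further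
  entries raises the index by one. For n = k - 1 the resulting ideal is zero; for n = k it consists
  of the multiples of e_{1k}.\<close>

lemma T2_ideal_N_gens_eval:
  fixes p :: "'a::field ncpoly" and \<phi> :: "var \<Rightarrow> 'a mat"
  assumes "3 \<le> k" "2 \<le> n" "p \<in> T2_ideal (N_gens k)" "triv_graded_eval (N_alg n) n \<phi>"
  shows "ncevalm n \<phi> p \<in> row_ideal n (k - 2)"
proof (rule T2_ideal_eval_row_ideal[OF assms(2) _ assms(3,4)])
  fix p :: "'a ncpoly" and \<phi> :: "var \<Rightarrow> 'a mat" assume p: "p \<in> N_gens k" and \<phi>: "triv_graded_eval (N_alg n) n \<phi>"
  note c = triv_graded_eval_carrier[OF \<phi>]
  have comm: "ncevalm n \<phi> (nccomm a b) \<in> row_ideal n 1" for a b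
    using commutator_row_ideal_1[OF assms(2) ncevalm_N_alg[OF assms(2) \<phi>] ncevalm_N_alg[OF assms(2) \<phi>]]
    by (simp add: ncevalm_nccomm[OF c])
  from p consider "p = nccomms (ncvar (Yv 1)) (map (\<lambda>i. ncvar (Yv i)) [2..<k])"
    | "p = nccomm (ncvar (Yv 1)) (ncvar (Yv 2)) * nccomm (ncvar (Yv 3)) (ncvar (Yv 4))"
    | "p = ncvar (Zv 1)" by (auto simp: ncmul_eq N_gens_def)
  then show "ncevalm n \<phi> p \<in> row_ideal n (k - 2)"
  proof cases
    case 1
    have "[2..<k] = 2 # [3..<k]" using assms(1) by (simp add: upt_conv_Cons)
    then have "p = nccomms (nccomm (ncvar (Yv 1)) (ncvar (Yv 2))) (map (\<lambda>i. ncvar (Yv i)) [3..<k])"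
      using 1 by (simp add: nccomms_Cons)
    moreover have "Suc (k - 3) = k - 2" using assms(1) by simp
    ultimately show ?thesis
      using ncevalm_nccomms_row_ideal[OF assms(2) \<phi> comm, of "ncvar (Yv 1)" "ncvar (Yv 2)" "map (\<lambda>i. ncvar (Yv i)) [3..<k]"]
      by simp
  next
    case 2
    then show ?thesis
      using row_ideal_mult_row_ideal[OF comm comm] row_ideal_zero by (simp add: ncevalm_mult[OF c])
  next
    case 3
    then show ?thesis using \<phi> row_ideal_zero by (simp add: ncevalm_ncvar[OF c] triv_graded_eval_def)
  qed
qed

subsection \<open>Computations modulo the T-ideal\<close>

lemma T2_ideal_mult_left: "p \<in> T2_ideal S \<Longrightarrow> q * p \<in> T2_ideal S"
  using T2_ideal.mult_left[of p S q] by (simp add: ncmul_eq)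

lemma T2_ideal_mult_right: "p \<in> T2_ideal S \<Longrightarrow> p * q \<in> T2_ideal S"
  using T2_ideal.mult_right[of p S q] by (simp add: ncmul_eq)

lemma T2_ideal_uminus: "p \<in> T2_ideal S \<Longrightarrow> - p \<in> T2_ideal S"
  using T2_ideal_mult_left[of p S "- 1"] by simp

lemma T2_ideal_diff: "p \<in> T2_ideal S \<Longrightarrow> q \<in> T2_ideal S \<Longrightarrow> p - q \<in> T2_ideal S"
  using T2_ideal.add[OF _ T2_ideal_uminus, of p S q] by simp

lemma T2_ideal_trans: "p - q \<in> T2_ideal S \<Longrightarrow> q - r \<in> T2_ideal S \<Longrightarrow> p - r \<in> T2_ideal S"
  using T2_ideal.add[of "p - q" S "q - r"] by simp

lemma T2_ideal_sum_mset_diff: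
  "(\<And>x. x \<in># M \<Longrightarrow> f x - g x \<in> T2_ideal S) \<Longrightarrow> (\<Sum>x\<in>#M. f x) - (\<Sum>x\<in>#M. g x) \<in> T2_ideal S"
proof (induction M)
  case empty
  then show ?case by (simp add: T2_ideal.zero)
next
  case (add x M)
  then have "(f x - g x) + ((\<Sum>x\<in>#M. f x) - (\<Sum>x\<in>#M. g x)) \<in> T2_ideal S"
    by (intro T2_ideal.add) auto
  then show ?case by (simp add: algebra_simps)
qed

lemma sum_mset_diff: "(\<Sum>x\<in>#M. f x - g x) = (\<Sum>x\<in>#M. f x) - (\<Sum>x\<in>#M. g x :: 'b::ab_group_add)"
  by (induction M) simp_all

lemma nccomm_add_left: "nccomm (p + q) r = nccomm p r + nccomm q r"
  by (simp add: nccomm_eq algebra_simps)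

lemma nccomms_add_left: "nccomms (p + q) rs = nccomms p rs + nccomms q rs"
  by (induction rs arbitrary: p q) (simp_all add: nccomms_Nil nccomms_Cons nccomm_add_left)

lemma nccomms_diff_left: "nccomms (p - q) rs = nccomms p rs - nccomms q rs"
  by (metis add_diff_cancel diff_add_cancel nccomms_add_left)

lemma nccomms_T2_ideal: "p \<in> T2_ideal S \<Longrightarrow> nccomms p rs \<in> T2_ideal S"
  by (induction rs arbitrary: p)
    (simp_all add: nccomms_Nil nccomms_Cons nccomm_eq T2_ideal_diff T2_ideal_mult_left T2_ideal_mult_right)

text \<open>Insertion sort: adjacent transpositions generate all permutations.\<close>

lemma mset_eq_adjacent_swap_induct [consumes 1, case_names refl trans swap]:
  assumes "mset xs = mset ys"
    and refl: "\<And>xs. R xs xs"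
    and trans: "\<And>xs ys zs. R xs ys \<Longrightarrow> R ys zs \<Longrightarrow> R xs zs"
    and swap: "\<And>xs a b ys. R (xs @ a # b # ys) (xs @ b # a # ys)"
  shows "R xs ys"
proof -
  have move: "R (pre @ us @ x # vs) (pre @ x # us @ vs)" for pre us x vs
  proof (induction us arbitrary: vs rule: rev_induct)
    case Nil
    then show ?case by (simp add: refl)
  next
    case (snoc z us)
    from swap[of "pre @ us" z x vs] snoc[of "z # vs"] show ?case
      by (auto intro: trans)
  qed
  \<comment> \<open>The prefix is generalised because \<open>R\<close> is not assumed to be
    compatible with prepending letters.\<close>
  have "R (pre @ xs) (pre @ ys)" for pre
    using assms(1)
  proof (induction ys arbitrary: xs pre)
    case Nil
    then show ?case by (simp add: refl)
  next
    case (Cons y ys)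
    then have "y \<in> set xs" by (metis list.set_intros(1) set_mset_mset)
    then obtain us vs where xs: "xs = us @ y # vs" by (metis split_list)
    then have "mset (us @ vs) = mset ys" using Cons.prems by simp
    from Cons.IH[OF this, of "pre @ [y]"] move[of pre us y vs] show ?case
      unfolding xs by (auto intro: trans)
  qed
  from this[of "[]"] show ?thesis by simp
qed

section \<open>Words and left-normed commutators in the even variables\<close>

definition yword :: "nat list \<Rightarrow> 'a::field ncpoly" where
  "yword u = mon (map Yv u) 1"

lemma yword_append: "yword (u @ v) = yword u * yword v"
  by (simp add: yword_def mon_mult)

lemma yword_Nil: "yword [] = 1"
  by (simp add: yword_def mon_Nil_1)

lemma ncvar_Yv: "ncvar (Yv i) = yword [i]"
  by (simp add: yword_def ncvar_def)

lemma homog_even_yword: "homog_even (yword u)"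
  by (auto simp: homog_even_def yword_def word_odd_def is_odd_var_def filter_map o_def)

definition ycomm :: "nat \<Rightarrow> nat \<Rightarrow> nat list \<Rightarrow> 'a::field ncpoly" where
  "ycomm i j s = nccomms (nccomm (yword [i]) (yword [j])) (map (\<lambda>l. yword [l]) s)"

lemma ycomm_Nil: "ycomm i j [] = nccomm (yword [i]) (yword [j])"
  by (simp add: ycomm_def nccomms_Nil)

lemma ycomm_append: "ycomm i j (s @ t) = nccomms (ycomm i j s) (map (\<lambda>l. yword [l]) t)"
  by (simp add: ycomm_def nccomms_append)

lemma ycomm_snoc: "ycomm i j (s @ [l]) = ycomm i j s * yword [l] - yword [l] * ycomm i j s"
  by (simp add: ycomm_append nccomms_Cons nccomms_Nil nccomm_eq)

lemma ycomm_swap: "ycomm j i s = - ycomm i j s"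
proof -
  have "nccomms (0 :: 'a ncpoly) rs = 0" for rs
    by (induction rs) (simp_all add: nccomms_Nil nccomms_Cons nccomm_eq)
  moreover have "ycomm j i s + ycomm i j s = nccomms (0 :: 'a ncpoly) (map (\<lambda>l. yword [l]) s)"
    by (simp add: ycomm_def nccomm_eq flip: nccomms_add_left)
  ultimately show ?thesis by (simp add: eq_neg_iff_add_eq_0)
qed

text \<open>The Jacobi identity for the first three letters, bracketed with the rest. It brings i
  and j back to the front after the differential has moved one of them into the tail.\<close>

lemma ycomm_jacobi: "ycomm i l (j # s) - ycomm j l (i # s) = ycomm i j (l # s)"
proof -
  have "nccomm (nccomm a c) b - nccomm (nccomm b c) a = nccomm (nccomm a b) c" for a b c :: "'a ncpoly"
    by (simp add: nccomm_eq algebra_simps)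
  then show ?thesis
    by (simp add: ycomm_def nccomms_Cons flip: nccomms_diff_left)
qed

lemma T2_ideal_Zv:
  assumes "Zv i \<in> set w"
  shows "mon w c \<in> T2_ideal (N_gens k)"
proof -
  define \<sigma> :: "var \<Rightarrow> 'a ncpoly" where
    "\<sigma> v = (case v of Yv l \<Rightarrow> ncvar (Yv l) | Zv _ \<Rightarrow> ncvar (Zv i))" for v
  have "graded_subst \<sigma>"
    by (simp add: graded_subst_def \<sigma>_def ncvar_def homog_even_def homog_odd_def word_odd_def is_odd_var_def)
  then have "ncsubst \<sigma> (ncvar (Zv 1)) \<in> T2_ideal (N_gens k)"
    by (intro T2_ideal.subst T2_ideal.gen) (auto simp: N_gens_def)
  then have z: "ncvar (Zv i) \<in> T2_ideal (N_gens k :: 'a ncpoly set)"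
    by (simp add: ncsubst_ncvar \<sigma>_def)
  obtain u v where w: "w = u @ [Zv i] @ v"
    using assms by (metis append_Cons append_Nil split_list)
  have "mon w c = mon u c * (ncvar (Zv i) * mon v 1)"
    by (simp add: w ncvar_def mon_mult)
  then show ?thesis using z by (simp add: T2_ideal_mult_left T2_ideal_mult_right)
qed

lemma T2_ideal_commutator_product:
  assumes "homog_even a" "homog_even b" "homog_even c" "homog_even d"
  shows "nccomm a b * nccomm c d \<in> T2_ideal (N_gens k)"
proof -
  define \<sigma> :: "var \<Rightarrow> 'a ncpoly" where
    "\<sigma> v = (case v of Yv l \<Rightarrow> (if l = 1 then a else if l = 2 then b else if l = 3 then c else d)
      | Zv i \<Rightarrow> ncvar (Zv i))" for v
  have "graded_subst \<sigma>"
    using assms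
    by (simp add: graded_subst_def \<sigma>_def ncvar_def homog_odd_def word_odd_def is_odd_var_def)
  then have "ncsubst \<sigma> (ncmul (nccomm (ncvar (Yv 1)) (ncvar (Yv 2))) (nccomm (ncvar (Yv 3)) (ncvar (Yv 4))))
      \<in> T2_ideal (N_gens k)"
    by (intro T2_ideal.subst T2_ideal.gen) (auto simp: N_gens_def)
  then show ?thesis
    by (simp add: ncmul_eq ncsubst_mult ncsubst_nccomm ncsubst_ncvar \<sigma>_def)
qed

lemma T2_ideal_long_ycomm:
  assumes "3 \<le> k" "k \<le> length s + 3"
  shows "ycomm i j s \<in> T2_ideal (N_gens k)"
proof -
  \<comment> \<open>The first k - 1 letters of the commutator, namely i, j and \<open>s1\<close>,
    form a substitution instance of the long generator; further brackets stay in the ideal.\<close>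
  define s1 where "s1 = take (k - 3) s"
  have len: "length s1 = k - 3" using assms by (simp add: s1_def)
  define \<sigma> :: "var \<Rightarrow> 'a ncpoly" where
    \<comment> \<open>The variables of the generator are numbered from 1, list positions from
      0.\<close>
    "\<sigma> v = (case v of Yv l \<Rightarrow> yword [(i # j # s1) ! (l - 1)] | Zv i \<Rightarrow> ncvar (Zv i))" for v
  have "graded_subst \<sigma>"
    by (simp add: graded_subst_def \<sigma>_def homog_even_yword ncvar_def homog_odd_def word_odd_def is_odd_var_def)
  then have "ncsubst \<sigma> (nccomms (ncvar (Yv 1)) (map (\<lambda>i. ncvar (Yv i)) [2..<k])) \<in> T2_ideal (N_gens k)"
    by (intro T2_ideal.subst T2_ideal.gen) (auto simp: N_gens_def)
  moreover have "map (\<lambda>l. \<sigma> (Yv l)) [2..<k] = map (\<lambda>l. yword [l]) (j # s1)"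
    by (rule nth_equalityI) (use len assms in \<open>auto simp: \<sigma>_def nth_Cons'\<close>)
  ultimately have "ycomm i j s1 \<in> T2_ideal (N_gens k :: 'a ncpoly set)"
    by (simp add: ncsubst_nccomms ncsubst_ncvar o_def ycomm_def nccomms_Cons) (simp add: \<sigma>_def)
  then show ?thesis
    using ycomm_append[of i j s1 "drop (k - 3) s", where ?'a = 'a] by (simp add: s1_def nccomms_T2_ideal)
qed

text \<open>The derivation rule [vc,d] = v[c,d] + [v,d]c removes the word in the middle, leaving
  products of two adjacent commutators of even elements.\<close>

lemma T2_ideal_commutator_word_commutator:
  "nccomm (yword [a]) (yword [b]) * yword v * nccomm (yword [c]) (yword [d]) \<in> T2_ideal (N_gens k)"
proof -
  let ?ab = "nccomm (yword [a]) (yword [b]) :: 'a ncpoly"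
  have "?ab * yword v * nccomm (yword [c]) (yword [d]) =
    ?ab * nccomm (yword (v @ [c])) (yword [d]) - ?ab * nccomm (yword v) (yword [d]) * yword [c]"
    by (simp add: nccomm_eq yword_append algebra_simps)
  then show ?thesis
    by (simp add: T2_ideal_diff T2_ideal_mult_right T2_ideal_commutator_product homog_even_yword)
qed

text \<open>Expanding the last bracket puts its letter either at the right end or into the middle
  word; this is why the induction needs an arbitrary \<open>v\<close>.\<close>

lemma T2_ideal_commutator_word_ycomm:
  "nccomm (yword [a]) (yword [b]) * yword v * ycomm i j s \<in> T2_ideal (N_gens k)"
proof (induction s arbitrary: v rule: rev_induct)
  case Nil
  then show ?case by (simp add: ycomm_Nil T2_ideal_commutator_word_commutator)
next
  case (snoc l s)
  let ?ab = "nccomm (yword [a]) (yword [b]) :: 'a ncpoly"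
  have "?ab * yword v * ycomm i j (s @ [l]) =
      ?ab * yword v * ycomm i j s * yword [l] - ?ab * yword (v @ [l]) * ycomm i j s"
    by (simp add: ycomm_snoc yword_append algebra_simps)
  then show ?case using snoc by (simp add: T2_ideal_diff T2_ideal_mult_right)
qed

lemma T2_ideal_ycomm_word_commutator:
  "ycomm i j s * (yword v * nccomm (yword [a]) (yword [b])) \<in> T2_ideal (N_gens k)"
proof (induction s arbitrary: v rule: rev_induct)
  case Nil
  then show ?case using T2_ideal_commutator_word_commutator by (simp add: ycomm_Nil mult.assoc)
next
  case (snoc l s)
  let ?ab = "nccomm (yword [a]) (yword [b]) :: 'a ncpoly"
  have "ycomm i j (s @ [l]) * (yword v * ?ab) =
      ycomm i j s * (yword ([l] @ v) * ?ab) - yword [l] * (ycomm i j s * (yword v * ?ab))"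
    unfolding yword_append by (simp add: ycomm_snoc algebra_simps)
  then show ?case using snoc[of "[l] @ v"] snoc[of v] by (simp only: T2_ideal_diff T2_ideal_mult_left)
qed

text \<open>An adjacent swap in the word produces a commutator to the left of
  \<open>ycomm i j s\<close>, and such products lie in the ideal.\<close>

lemma yword_perm_cong:
  assumes "mset u = mset u'"
  shows "yword u * ycomm i j s - yword u' * ycomm i j s \<in> T2_ideal (N_gens k)"
  using assms
proof (induction rule: mset_eq_adjacent_swap_induct)
  case (refl xs)
  then show ?case by (simp add: T2_ideal.zero)
next
  case (trans xs ys zs)
  then show ?case by (rule T2_ideal_trans)
next
  case (swap xs a b ys)
  have split: "yword (xs @ a # b # ys) = yword xs * yword [a] * yword [b] * (yword ys :: 'a ncpoly)" for a b
    by (simp add: yword_def mon_mult)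
  have "yword (xs @ a # b # ys) * ycomm i j s - yword (xs @ b # a # ys) * (ycomm i j s :: 'a ncpoly) =
      yword xs * (nccomm (yword [a]) (yword [b]) * yword ys * ycomm i j s)"
    unfolding split by (simp add: nccomm_eq algebra_simps)
  then show ?case by (simp add: T2_ideal_mult_left T2_ideal_commutator_word_ycomm)
qed

text \<open>[K,a,b] - [K,b,a] = [K,[a,b]], and both products of K with [a,b] lie in the
  ideal.\<close>

lemma ycomm_perm_cong:
  assumes "mset s = mset s'"
  shows "ycomm i j s - ycomm i j s' \<in> T2_ideal (N_gens k)"
  using assms
proof (induction rule: mset_eq_adjacent_swap_induct)
  case (refl xs)
  then show ?case by (simp add: T2_ideal.zero)
next
  case (trans xs ys zs)
  then show ?case by (rule T2_ideal_trans)
next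
  case (swap xs a b ys)
  let ?K = "ycomm i j xs :: 'a ncpoly" and ?ab = "nccomm (yword [a]) (yword [b]) :: 'a ncpoly"
  have "ycomm i j (xs @ a # b # ys) - ycomm i j (xs @ b # a # ys) =
      nccomms (?K * ?ab - ?ab * ?K) (map (\<lambda>l. yword [l]) ys)"
    by (simp add: ycomm_append nccomms_Cons flip: nccomms_diff_left) (simp add: nccomm_eq algebra_simps)
  moreover have "?K * ?ab \<in> T2_ideal (N_gens k)" "?ab * ?K \<in> T2_ideal (N_gens k)"
    using T2_ideal_ycomm_word_commutator[of i j xs "[]" a b k] T2_ideal_commutator_word_ycomm[of a b "[]" i j xs k]
    by (simp_all add: yword_Nil)
  ultimately show ?case by (simp add: nccomms_T2_ideal T2_ideal_diff)
qed

text \<open>Modulo the T-ideal u and s thus matter only as multisets, and the sorted representatives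
  in \<open>ycomm_mset\<close> are as good as any others.\<close>

lemma yword_ycomm_perm_cong:
  assumes "mset u = mset u'" "mset s = mset s'"
  shows "yword u * ycomm i j s - yword u' * ycomm i j s' \<in> T2_ideal (N_gens k)"
proof (rule T2_ideal_trans)
  show "yword u * ycomm i j s - yword u' * ycomm i j s \<in> T2_ideal (N_gens k)"
    by (rule yword_perm_cong[OF assms(1)])
  show "yword u' * ycomm i j s - yword u' * ycomm i j s' \<in> T2_ideal (N_gens k)"
    using T2_ideal_mult_left[OF ycomm_perm_cong[OF assms(2)], of "yword u'"] by (simp add: right_diff_distrib)
qed

section \<open>The Koszul contracting homotopy\<close>

definition ycomm_mset :: "nat multiset \<Rightarrow> nat \<Rightarrow> nat \<Rightarrow> nat multiset \<Rightarrow> 'a::field ncpoly" where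
  "ycomm_mset \<alpha> i j \<beta> = yword (sorted_list_of_multiset \<alpha>) * ycomm i j (sorted_list_of_multiset \<beta>)"

text \<open>A triple (\<alpha>, i, \<beta>) stands for the tensor y^\<alpha> \<otimes> e_i \<otimes> x^\<beta>, where x_l is the operator
  [-, y_l]. The homotopy sends e_i \<otimes> g to the sum over l of [y_i, y_l] (\<partial>g / \<partial>x_l), divided by
  deg g + 1, the eigenvalue of homotopy composed with differential in that degree.\<close>

definition koszul_homotopy :: "nat multiset \<times> nat \<times> nat multiset \<Rightarrow> 'a::field ncpoly" where
  "koszul_homotopy = (\<lambda>(\<alpha>, i, \<beta>). mon [] (1 / of_nat (size \<beta> + 1)) *
    (\<Sum>l\<in>#\<beta>. ycomm_mset \<alpha> i l (\<beta> - {#l#})))"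

text \<open>Homotopy after differential is the identity on e_i \<and> e_j \<otimes> s. Before
  division each letter of s contributes one copy of X by the Jacobi identity, and the moved letters
  j and i contribute one copy each. The total length s + 2 is the denominator for a tail of size
  length s + 1.\<close>

lemma koszul_homotopy_boundary:
  fixes u :: "nat list"
  shows "koszul_homotopy (mset u, i, add_mset j (mset s)) - koszul_homotopy (mset u, j, add_mset i (mset s))
    - yword u * ycomm i j s \<in> T2_ideal (N_gens k :: 'a::field_char_0 ncpoly set)"
proof -
  let ?T = "T2_ideal (N_gens k :: 'a ncpoly set)"
  let ?c = "\<lambda>i j \<beta>. ycomm_mset (mset u) i j \<beta> :: 'a ncpoly"
  let ?s = "mset s" and ?d = "size (mset s)"
  define X where "X = ?c i j ?s"
  have "?c i l (add_mset j ?s - {#l#}) - ?c j l (add_mset i ?s - {#l#}) - X \<in> ?T" if l: "l \<in># ?s" for l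
  proof -
    define v where "v = sorted_list_of_multiset (mset u)"
    define t where "t = sorted_list_of_multiset (?s - {#l#})"
    have A: "?c i l (add_mset j ?s - {#l#}) - yword v * ycomm i l (j # t) \<in> ?T"
      unfolding ycomm_mset_def v_def by (rule yword_ycomm_perm_cong) (use l in \<open>auto simp: t_def\<close>)
    have B: "?c j l (add_mset i ?s - {#l#}) - yword v * ycomm j l (i # t) \<in> ?T"
      unfolding ycomm_mset_def v_def by (rule yword_ycomm_perm_cong) (use l in \<open>auto simp: t_def\<close>)
    have C: "yword v * ycomm i j (l # t) - X \<in> ?T"
      unfolding ycomm_mset_def v_def X_def by (rule yword_ycomm_perm_cong) (use l in \<open>auto simp: t_def\<close>)
    have D: "yword v * ycomm i j (l # t) = (yword v * ycomm i l (j # t) - yword v * ycomm j l (i # t) :: 'a ncpoly)"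
      by (simp only: ycomm_jacobi flip: right_diff_distrib)
    from T2_ideal.add[OF T2_ideal_diff[OF A B] C] show ?thesis
      by (simp add: D algebra_simps)
  qed
  then have "(\<Sum>l\<in>#?s. ?c i l (add_mset j ?s - {#l#}) - ?c j l (add_mset i ?s - {#l#})) - (\<Sum>l\<in>#?s. X) \<in> ?T"
    by (intro T2_ideal_sum_mset_diff) auto
  moreover have "?c j i ?s = - X"
    by (simp add: X_def ycomm_mset_def ycomm_swap[of j i])
  ultimately have *: "(\<Sum>l\<in>#add_mset j ?s. ?c i l (add_mset j ?s - {#l#}))
      - (\<Sum>l\<in>#add_mset i ?s. ?c j l (add_mset i ?s - {#l#})) - of_nat (?d + 2) * X \<in> ?T"
    by (simp add: X_def[symmetric] sum_mset_diff algebra_simps)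
  \<comment> \<open>The integer d + 2 of the free algebra is a constant polynomial, invertible in
    characteristic zero.\<close>
  have "mon [] (1 / of_nat (?d + 2)) * (of_nat (?d + 2) :: 'a ncpoly) = mon [] (1 / of_nat (?d + 2)) * mon [] (of_nat (?d + 2))"
    by (metis single_of_nat zero_list_def)
  also have "\<dots> = 1"
    using of_nat_neq_0[of "Suc ?d", where ?'a = 'a] by (simp add: mon_mult mon_Nil_1)
  finally have "mon [] (1 / of_nat (?d + 2)) * (of_nat (?d + 2) * X) = X"
    by (simp add: mult.assoc[symmetric])
  then have "mon [] (1 / of_nat (?d + 2)) * (\<Sum>l\<in>#add_mset j ?s. ?c i l (add_mset j ?s - {#l#}))
      - mon [] (1 / of_nat (?d + 2)) * (\<Sum>l\<in>#add_mset i ?s. ?c j l (add_mset i ?s - {#l#})) - X \<in> ?T"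
    using T2_ideal_mult_left[OF *, of "mon [] (1 / of_nat (?d + 2))"] by (simp only: right_diff_distrib)
  moreover have "koszul_homotopy (mset u, a, add_mset b ?s) =
      mon [] (1 / of_nat (?d + 2)) * (\<Sum>l\<in>#add_mset b ?s. ?c a l (add_mset b ?s - {#l#}))" for a b
  proof -
    have "size (add_mset b ?s) + 1 = ?d + 2" by simp
    then show ?thesis by (simp only: koszul_homotopy_def prod.case)
  qed
  ultimately have "koszul_homotopy (mset u, i, add_mset j ?s) - koszul_homotopy (mset u, j, add_mset i ?s) - X \<in> ?T"
    by (simp only:)
  moreover have "X - yword u * ycomm i j s \<in> ?T"
    unfolding X_def ycomm_mset_def by (rule yword_ycomm_perm_cong) auto
  ultimately show ?thesis by (rule T2_ideal_trans)
qed

subsection \<open>Independence of monomial functions\<close>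

text \<open>Dedekind's argument for an arbitrary binary operation \<open>m\<close>: subtracting
  \<chi>_t(y) times the relation at x from the relation at \<open>m y x\<close> eliminates t, and
  the coefficient of s is multiplied by \<chi>_s(y) - \<chi>_t(y), which is nonzero for a suitable
  y.\<close>

lemma characters_independent:
  fixes \<chi> :: "'s \<Rightarrow> 'x \<Rightarrow> 'a::field"
  assumes "finite S"
    and "\<And>s x y. s \<in> S \<Longrightarrow> \<chi> s (m x y) = \<chi> s x * \<chi> s y"
    and "\<And>s. s \<in> S \<Longrightarrow> \<exists>x. \<chi> s x \<noteq> 0"
    and "\<And>s t. s \<in> S \<Longrightarrow> t \<in> S \<Longrightarrow> s \<noteq> t \<Longrightarrow> \<exists>x. \<chi> s x \<noteq> \<chi> t x"
    and "\<And>x. (\<Sum>s\<in>S. c s * \<chi> s x) = 0"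
    and "s \<in> S"
  shows "c s = 0"
  using assms
proof (induction S arbitrary: c s rule: finite_induct)
  case empty
  then show ?case by simp
next
  case (insert t F)
  have sum: "c t * \<chi> t x + (\<Sum>s\<in>F. c s * \<chi> s x) = 0" for x
    using insert.prems(4)[of x] insert.hyps by simp
  have F: "c s = 0" if s: "s \<in> F" for s
  proof -
    obtain y where y: "\<chi> s y \<noteq> \<chi> t y"
      using insert.prems(3)[of s t] s insert.hyps by auto
    have "(\<Sum>s\<in>F. c s * (\<chi> s y - \<chi> t y) * \<chi> s x) = 0" for x
    proof -
      have "(\<Sum>s\<in>F. c s * (\<chi> s y - \<chi> t y) * \<chi> s x) =
          (\<Sum>s\<in>F. c s * \<chi> s (m y x)) - \<chi> t y * (\<Sum>s\<in>F. c s * \<chi> s x)"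
        by (simp add: sum_distrib_left insert.prems(1) algebra_simps flip: sum_subtractf)
      also have "\<dots> = (c t * \<chi> t (m y x) + (\<Sum>s\<in>F. c s * \<chi> s (m y x)))
          - \<chi> t y * (c t * \<chi> t x + (\<Sum>s\<in>F. c s * \<chi> s x))"
        by (simp add: insert.prems(1) algebra_simps)
      finally show ?thesis by (simp add: sum)
    qed
    then have "c s * (\<chi> s y - \<chi> t y) = 0"
      using insert.IH[of "\<lambda>s. c s * (\<chi> s y - \<chi> t y)" s] insert.prems(1-3) s by auto
    then show ?thesis using y by simp
  qed
  then have "c t * \<chi> t x = 0" for x using sum[of x] by simp
  then have "c t = 0" using insert.prems(2)[of t] by auto
  then show ?case using F insert.prems(5) by auto
qed

lemma prod_mset_mult: "(\<Prod>v\<in>#\<alpha>. a v * b v) = (\<Prod>v\<in>#\<alpha>. a v) * (\<Prod>v\<in>#\<alpha>. b v :: 'a::comm_monoid_mult)"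
  by (induction \<alpha>) (simp_all add: ac_simps)

lemma prod_mset_count:
  "(\<Prod>v\<in>#\<alpha>. if v = x then 2 else 1) = (2 :: 'a::comm_semiring_1) ^ count \<alpha> x"
  by (induction \<alpha>) simp_all

text \<open>A letter with different multiplicities is sent to 2 and all others to 1; distinct powers
  of 2 stay distinct in characteristic zero.\<close>

lemma prod_mset_separates:
  assumes "\<alpha> \<noteq> \<beta>"
  shows "\<exists>a :: 'b \<Rightarrow> 'a::field_char_0. (\<Prod>v\<in>#\<alpha>. a v) \<noteq> (\<Prod>v\<in>#\<beta>. a v)"
proof -
  obtain x where x: "count \<alpha> x \<noteq> count \<beta> x" using assms by (meson multiset_eqI)
  then have "(2 :: nat) ^ count \<alpha> x \<noteq> 2 ^ count \<beta> x" by simp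
  then have "of_nat (2 ^ count \<alpha> x) \<noteq> (of_nat (2 ^ count \<beta> x) :: 'a)" by (simp only: of_nat_eq_iff not_False_eq_True)
  then show ?thesis
    by (intro exI[of _ "\<lambda>v. if v = x then 2 else 1"]) (simp add: prod_mset_count)
qed

text \<open>Grouping words by their commutative image turns the hypothesis into a relation between
  distinct characters of the multiplicative monoid of functions a.\<close>

lemma sum_words_vanish_imp_abelianization_zero:
  fixes c :: "'b list \<Rightarrow> 'a::field_char_0"
  assumes "finite K" "\<And>a. (\<Sum>w\<in>K. c w * (\<Prod>v\<leftarrow>w. a v)) = 0"
  shows "(\<Sum>w\<in>{w \<in> K. mset w = \<alpha>}. c w) = 0"
proof (cases "\<alpha> \<in> mset ` K")
  case True
  show ?thesis
  proof (rule characters_independent[of "mset ` K" "\<lambda>\<alpha> a. \<Prod>v\<in>#\<alpha>. a v" "\<lambda>a b v. a v * b v" _ \<alpha>])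
    fix a :: "'b \<Rightarrow> 'a"
    have "0 = (\<Sum>w\<in>K. c w * (\<Prod>v\<in>#mset w. a v))"
      using assms(2)[of a] by (simp flip: prod_mset_prod_list mset_map)
    also have "\<dots> = (\<Sum>\<alpha>\<in>mset ` K. \<Sum>w\<in>{w \<in> K. mset w = \<alpha>}. c w * (\<Prod>v\<in>#mset w. a v))"
      by (rule sum.image_gen[OF assms(1)])
    also have "\<dots> = (\<Sum>\<alpha>\<in>mset ` K. (\<Sum>w\<in>{w \<in> K. mset w = \<alpha>}. c w) * (\<Prod>v\<in>#\<alpha>. a v))"
      by (simp add: sum_distrib_right)
    finally show "(\<Sum>\<alpha>\<in>mset ` K. (\<Sum>w\<in>{w \<in> K. mset w = \<alpha>}. c w) * (\<Prod>v\<in>#\<alpha>. a v)) = 0" by simp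
  next
    fix \<alpha> :: "'b multiset"
    show "\<exists>a. (\<Prod>v\<in>#\<alpha>. a v) \<noteq> (0 :: 'a)" by (rule exI[of _ "\<lambda>_. 1"]) simp
  qed (use True assms(1) prod_mset_separates in \<open>auto simp: prod_mset_mult\<close>)
next
  case False
  then have "{w \<in> K. mset w = \<alpha>} = {}" by auto
  then show ?thesis by (simp only: sum.empty)
qed

subsection \<open>Expansions in commutators\<close>

text \<open>The second argument records the Koszul differential of a representation of the first one
  as a combination of commutators modulo the T-ideal.\<close>

inductive comm_expansion ::
  "nat \<Rightarrow> 'a::field ncpoly \<Rightarrow> (nat multiset \<times> nat \<times> nat multiset \<Rightarrow>\<^sub>0 'a) \<Rightarrow> bool" for k where
  ideal: "p \<in> T2_ideal (N_gens k) \<Longrightarrow> comm_expansion k p 0"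
| comm: "length s + 4 \<le> k \<Longrightarrow> comm_expansion k (mon [] c * (yword u * ycomm i j s))
    (mon (mset u, i, add_mset j (mset s)) c - mon (mset u, j, add_mset i (mset s)) c)"
| add: "comm_expansion k p \<kappa> \<Longrightarrow> comm_expansion k q \<mu> \<Longrightarrow> comm_expansion k (p + q) (\<kappa> + \<mu>)"

text \<open>The linear extension of \<open>koszul_homotopy_boundary\<close>. It will be used with
  \<kappa> = 0, where it places p in the T-ideal.\<close>

lemma comm_expansion_koszul_homotopy:
  fixes p :: "'a::field_char_0 ncpoly"
  assumes "comm_expansion k p \<kappa>"
  shows "(\<Sum>t\<in>Poly_Mapping.keys \<kappa>. mon [] (Poly_Mapping.lookup \<kappa> t) * koszul_homotopy t) - p
    \<in> T2_ideal (N_gens k)"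
  using assms
proof (induction rule: comm_expansion.induct)
  case (ideal p)
  then show ?case by (simp add: T2_ideal_uminus)
next
  case (add p \<kappa> q \<mu>)
  have "(\<Sum>t\<in>Poly_Mapping.keys (\<kappa> + \<mu>). mon [] (Poly_Mapping.lookup (\<kappa> + \<mu>) t) * koszul_homotopy t) =
      (\<Sum>t\<in>Poly_Mapping.keys \<kappa>. mon [] (Poly_Mapping.lookup \<kappa> t) * koszul_homotopy t) +
      (\<Sum>t\<in>Poly_Mapping.keys \<mu>. mon [] (Poly_Mapping.lookup \<mu> t) * (koszul_homotopy t :: 'a ncpoly))"
    by (rule sum_keys_add) (simp_all add: single_add distrib_right)
  then show ?case using T2_ideal.add[OF add.IH] by (simp add: algebra_simps)
next
  case (comm s c u i j)
  let ?t = "(mset u, i, add_mset j (mset s))" and ?t' = "(mset u, j, add_mset i (mset s))"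
  \<comment> \<open>The difference is written as a sum so that \<open>sum_keys_add\<close>
    applies.\<close>
  let ?\<kappa> = "mon ?t c + mon ?t' (- c)"
  have "(\<Sum>t\<in>Poly_Mapping.keys ?\<kappa>. mon [] (Poly_Mapping.lookup ?\<kappa> t) * koszul_homotopy t) =
      (\<Sum>t\<in>Poly_Mapping.keys (mon ?t c). mon [] (Poly_Mapping.lookup (mon ?t c) t) * koszul_homotopy t) +
      (\<Sum>t\<in>Poly_Mapping.keys (mon ?t' (- c)). mon [] (Poly_Mapping.lookup (mon ?t' (- c)) t) * (koszul_homotopy t :: 'a ncpoly))"
    by (rule sum_keys_add) (simp_all add: single_add distrib_right)
  also have "\<dots> = mon [] c * (koszul_homotopy ?t - koszul_homotopy ?t')"
    by (simp add: single_uminus right_diff_distrib)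
  finally have "(\<Sum>t\<in>Poly_Mapping.keys ?\<kappa>. mon [] (Poly_Mapping.lookup ?\<kappa> t) * koszul_homotopy t)
      - mon [] c * (yword u * ycomm i j s) =
      mon [] c * (koszul_homotopy ?t - koszul_homotopy ?t' - yword u * ycomm i j s)"
    by (simp only: right_diff_distrib)
  moreover have "?\<kappa> = mon ?t c - mon ?t' c" by (simp add: single_uminus)
  ultimately show ?case
    using T2_ideal_mult_left[OF koszul_homotopy_boundary] by (simp only:)
qed

section \<open>Reduction of polynomials with zero commutative image to commutators\<close>

definition expandable :: "nat \<Rightarrow> 'a::field ncpoly \<Rightarrow> bool" where
  "expandable k p \<longleftrightarrow> (\<exists>\<kappa>. comm_expansion k p \<kappa>)"

lemma expandable_ideal: "p \<in> T2_ideal (N_gens k) \<Longrightarrow> expandable k p"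
  unfolding expandable_def by (blast intro: comm_expansion.ideal)

lemma expandable_add: "expandable k p \<Longrightarrow> expandable k q \<Longrightarrow> expandable k (p + q)"
  unfolding expandable_def by (blast intro: comm_expansion.add)

lemma expandable_sum: "(\<And>x. x \<in> A \<Longrightarrow> expandable k (f x)) \<Longrightarrow> expandable k (\<Sum>x\<in>A. f x)"
  by (induction A rule: infinite_finite_induct)
    (auto intro: expandable_add expandable_ideal T2_ideal.zero)

lemma expandable_comm:
  assumes "3 \<le> k"
  shows "expandable k (mon [] c * (yword u * ycomm i j s))"
proof (cases "length s + 4 \<le> k")
  case True
  then show ?thesis unfolding expandable_def by (blast intro: comm_expansion.comm)
next
  case False
  then show ?thesis
    using assms by (intro expandable_ideal T2_ideal_mult_left T2_ideal_long_ycomm) auto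
qed

lemma expandable_scalar:
  assumes "3 \<le> k" "expandable k p"
  shows "expandable k (mon [] c * p)"
proof -
  obtain \<kappa> where "comm_expansion k p \<kappa>" using assms(2) by (auto simp: expandable_def)
  then show ?thesis
  proof (induction rule: comm_expansion.induct)
    case (comm s c' u i j)
    then show ?case using expandable_comm[OF assms(1), of "c * c'"]
      by (simp add: mon_mult flip: mult.assoc)
  qed (auto simp: distrib_left intro: expandable_add expandable_ideal T2_ideal_mult_left)
qed

text \<open>K y_l = y_l K + [K, y_l]: the new letter joins the word on the left or the tail of the
  commutator.\<close>

lemma expandable_mult_var:
  assumes "3 \<le> k" "expandable k p"
  shows "expandable k (p * yword [l])"
proof -
  obtain \<kappa> where "comm_expansion k p \<kappa>" using assms(2) by (auto simp: expandable_def)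
  then show ?thesis
  proof (induction rule: comm_expansion.induct)
    case (comm s c u i j)
    have "mon [] c * (yword u * ycomm i j s) * yword [l] =
        mon [] c * (yword (u @ [l]) * ycomm i j s) + mon [] c * (yword u * (ycomm i j (s @ [l]) :: 'a ncpoly))"
      by (simp add: ycomm_snoc yword_append algebra_simps)
    then show ?case by (simp add: expandable_add expandable_comm assms(1))
  qed (auto simp: distrib_right intro: expandable_add expandable_ideal T2_ideal_mult_right)
qed

lemma expandable_mult_yword:
  assumes "3 \<le> k" "expandable k p"
  shows "expandable k (p * yword v)"
proof (induction v rule: rev_induct)
  case Nil
  then show ?case using assms(2) by (simp add: yword_Nil)
next
  case (snoc l v)
  then show ?case using expandable_mult_var[OF assms(1), of "p * yword v" l]
    by (simp add: yword_append mult.assoc)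
qed

text \<open>A swap leaves a commutator between two words; the word on its right is absorbed letter
  by letter.\<close>

lemma expandable_yword_diff:
  assumes "3 \<le> k" "mset u = mset u'"
  shows "expandable k (yword u - yword u' :: 'a::field ncpoly)"
  using assms(2)
proof (induction rule: mset_eq_adjacent_swap_induct)
  case (refl xs)
  then show ?case by (simp add: expandable_ideal T2_ideal.zero)
next
  case (trans xs ys zs)
  then show ?case using expandable_add[of k "yword xs - yword ys" "yword ys - yword zs"] by simp
next
  case (swap xs a b ys)
  have split: "yword (xs @ a # b # ys) = yword xs * yword [a] * yword [b] * (yword ys :: 'a ncpoly)" for a b
    by (simp add: yword_def mon_mult)
  have "yword (xs @ a # b # ys) - yword (xs @ b # a # ys) =
      mon [] 1 * (yword xs * ycomm a b []) * (yword ys :: 'a ncpoly)"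
    unfolding split by (simp add: ycomm_Nil nccomm_eq mon_Nil_1 algebra_simps)
  then show ?case
    using expandable_mult_yword[OF assms(1) expandable_comm[OF assms(1)]] by simp
qed

text \<open>Words with an odd variable lie in the ideal. Every other word is replaced by a fixed
  representative of its commutative image, at the cost of an expandable error; the representatives
  cancel by the hypothesis.\<close>

lemma expandable_abelianization_zero:
  fixes p :: "'a::field ncpoly"
  assumes "3 \<le> k"
    and "\<And>\<alpha>. (\<Sum>w\<in>{w \<in> {w \<in> Poly_Mapping.keys p. set w \<subseteq> range Yv}. mset w = \<alpha>}. Poly_Mapping.lookup p w) = 0"
  shows "expandable k p"
proof -
  let ?K = "{w \<in> Poly_Mapping.keys p. set w \<subseteq> range Yv}"
  let ?L = "Poly_Mapping.keys p - ?K"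
  define rep :: "var multiset \<Rightarrow> var list" where "rep \<alpha> = (SOME w. mset w = \<alpha>)" for \<alpha>
  have rep: "mset (rep \<alpha>) = \<alpha>" for \<alpha>
    unfolding rep_def by (rule someI_ex) (rule ex_mset)
  have "expandable k (mon w c - mon (rep (mset w)) c)" if w: "set w \<subseteq> range Yv" for w and c :: 'a
  proof -
    have "set (rep (mset w)) = set w" by (metis rep set_mset_mset)
    moreover have "\<exists>u. w' = map Yv u" if "set w' \<subseteq> range Yv" for w'
      using that by (auto simp: ex_map_conv)
    ultimately obtain u v where uv: "w = map Yv u" "rep (mset w) = map Yv v"
      using w by metis
    then have "image_mset Yv (mset u) = image_mset Yv (mset v)" by (metis mset_map rep)
    then have "mset u = mset v"
      using multiset.inj_map[of Yv] by (auto simp: inj_def)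
    then have "expandable k (mon [] c * (yword u - yword v))"
      by (intro expandable_scalar expandable_yword_diff assms(1))
    then show ?thesis unfolding uv(2) by (simp add: uv(1) yword_def right_diff_distrib mon_mult)
  qed
  then have "expandable k (\<Sum>w\<in>?K. mon w (Poly_Mapping.lookup p w) - mon (rep (mset w)) (Poly_Mapping.lookup p w))"
    by (intro expandable_sum) auto
  moreover have "(\<Sum>w\<in>?K. mon (rep (mset w)) (Poly_Mapping.lookup p w)) = 0"
  proof -
    have "(\<Sum>w\<in>?K. mon (rep (mset w)) (Poly_Mapping.lookup p w)) =
        (\<Sum>\<alpha>\<in>mset ` ?K. \<Sum>w\<in>{w \<in> ?K. mset w = \<alpha>}. mon (rep (mset w)) (Poly_Mapping.lookup p w))"
      by (rule sum.image_gen) simp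
    also have "\<dots> = (\<Sum>\<alpha>\<in>mset ` ?K. mon (rep \<alpha>) (\<Sum>w\<in>{w \<in> ?K. mset w = \<alpha>}. Poly_Mapping.lookup p w))"
    proof (rule sum.cong)
      fix \<alpha>
      have "mon (rep \<alpha>) (sum (Poly_Mapping.lookup p) A) = (\<Sum>w\<in>A. mon (rep \<alpha>) (Poly_Mapping.lookup p w))" for A
        by (induction A rule: infinite_finite_induct) (simp_all add: single_add)
      then show "(\<Sum>w\<in>{w \<in> ?K. mset w = \<alpha>}. mon (rep (mset w)) (Poly_Mapping.lookup p w)) =
          mon (rep \<alpha>) (\<Sum>w\<in>{w \<in> ?K. mset w = \<alpha>}. Poly_Mapping.lookup p w)" by simp
    qed simp
    also have "\<dots> = 0" using assms(2) by (simp only: single_zero sum.neutral_const)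
    finally show ?thesis .
  qed
  ultimately have K: "expandable k (\<Sum>w\<in>?K. mon w (Poly_Mapping.lookup p w))"
    by (simp add: sum_subtractf)
  have "mon w (Poly_Mapping.lookup p w) \<in> T2_ideal (N_gens k)" if "w \<in> ?L" for w
  proof -
    obtain v where "v \<in> set w" "v \<notin> range Yv" using \<open>w \<in> ?L\<close> by auto
    then obtain l where "Zv l \<in> set w" by (metis rangeI var.exhaust)
    then show ?thesis by (rule T2_ideal_Zv)
  qed
  then have L: "expandable k (\<Sum>w\<in>?L. mon w (Poly_Mapping.lookup p w))"
    by (intro expandable_sum expandable_ideal)
  have "(\<Sum>w\<in>?L. mon w (Poly_Mapping.lookup p w)) + (\<Sum>w\<in>?K. mon w (Poly_Mapping.lookup p w)) = p"
    by (subst sum.subset_diff[symmetric]) (auto simp: sum_mon_keys)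
  with expandable_add[OF L K] show ?thesis by (simp only:)
qed

subsection \<open>Generic evaluations\<close>

text \<open>Smat n a b r is the pair (a + b t, r), and Emat n x d is (0, x t^{d-1}).\<close>

definition Smat :: "nat \<Rightarrow> 'a::zero \<Rightarrow> 'a \<Rightarrow> 'a \<Rightarrow> 'a mat" where
  "Smat n a b r = Nmat n (\<lambda>j. if j = 1 then r else 0) (\<lambda>d. if d = 0 then a else if d = 1 then b else 0)"

lemma Smat_carrier [simp]: "Smat n a b r \<in> carrier_mat n n"
  by (simp add: Smat_def)

lemma Smat_dim [simp]: "dim_row (Smat n a b r) = n" "dim_col (Smat n a b r) = n"
  by (simp_all add: Smat_def)

lemma Smat_N_alg: "2 \<le> n \<Longrightarrow> Smat n a b r \<in> N_alg n"
  by (auto simp: N_alg_eq Smat_def)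

lemma Smat_index:
  "i < n \<Longrightarrow> j < n \<Longrightarrow> Smat n a b r $$ (i, j) =
    (if j = i then a else if j = Suc i then (if i = 0 then r else b) else 0)"
  by (auto simp: Smat_def Nmat_index)

lemma Smat_mult_index:
  fixes B :: "'a::comm_ring_1 mat"
  assumes "B \<in> carrier_mat n n" "i < n" "j < n"
  shows "(Smat n a b r * B) $$ (i, j) =
    a * B $$ (i, j) + (if Suc i < n then (if i = 0 then r else b) * B $$ (Suc i, j) else 0)"
proof -
  have "(Smat n a b r * B) $$ (i, j) = (\<Sum>l<n. (if l = i then a * B $$ (i, j) else 0) +
      (if l = Suc i then (if i = 0 then r else b) * B $$ (Suc i, j) else 0))"
    by (subst index_mult_mat_sum[OF Smat_carrier assms(1)], use assms in simp, use assms in simp, intro sum.cong)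
      (use assms in \<open>auto simp: Smat_index\<close>)
  then show ?thesis using assms by (simp add: sum.distrib)
qed

lemma mult_Smat_index:
  fixes B :: "'a::comm_ring_1 mat"
  assumes "B \<in> carrier_mat n n" "i < n" "j < n"
  shows "(B * Smat n a b r) $$ (i, j) =
    B $$ (i, j) * a + (if 0 < j then B $$ (i, j - 1) * (if j = 1 then r else b) else 0)"
proof -
  have "(B * Smat n a b r) $$ (i, j) = (\<Sum>l<n. (if l = j then B $$ (i, j) * a else 0) +
      (if l = j - 1 then (if 0 < j then B $$ (i, j - 1) * (if j = 1 then r else b) else 0) else 0))"
    by (subst index_mult_mat_sum[OF assms(1) Smat_carrier], use assms in simp, use assms in simp, intro sum.cong)
      (use assms in \<open>auto simp: Smat_index\<close>)
  then show ?thesis using assms by (simp add: sum.distrib)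
qed

definition Emat :: "nat \<Rightarrow> 'a::zero \<Rightarrow> nat \<Rightarrow> 'a mat" where
  "Emat n x d = mat n n (\<lambda>(i, j). if i = 0 \<and> j = d then x else 0)"

lemma Emat_carrier [simp]: "Emat n x d \<in> carrier_mat n n"
  by (simp add: Emat_def)

lemma Emat_dim [simp]: "dim_row (Emat n x d) = n" "dim_col (Emat n x d) = n"
  by (simp_all add: Emat_def)

lemma Emat_index: "i < n \<Longrightarrow> j < n \<Longrightarrow> Emat n x d $$ (i, j) = (if i = 0 \<and> j = d then x else 0)"
  by (simp add: Emat_def)

lemma Smat_mult_Emat: "Smat n a b r * Emat n x d = Emat n (a * x :: 'a::comm_ring_1) d"
  by (rule eq_matI) (auto simp: Smat_mult_index Emat_index simp del: index_mult_mat(1))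

text \<open>For d = 0 the new factor would be the first-row entry \<open>r\<close> instead of
  \<open>b\<close>, hence \<open>0 < d\<close>.\<close>

lemma Emat_Smat_commutator:
  assumes "0 < d"
  shows "Emat n x d * Smat n a b r - Smat n a b r * Emat n x d = Emat n (x * b :: 'a::comm_ring_1) (Suc d)"
  using assms unfolding Smat_mult_Emat
  by (intro eq_matI) (auto simp: mult_Smat_index Emat_index mult.commute simp del: index_mult_mat(1))

lemma Smat_commutator:
  "Smat n a b r * Smat n a' b' r' - Smat n a' b' r' * Smat n a b r = Emat n (r * b' - r' * b :: 'a::comm_ring_1) 2"
  by (rule eq_matI)
    (auto simp: Smat_mult_index Smat_index Emat_index algebra_simps simp del: index_mult_mat(1))

definition Seval :: "nat \<Rightarrow> (nat \<Rightarrow> 'a::zero) \<Rightarrow> (nat \<Rightarrow> 'a) \<Rightarrow> (nat \<Rightarrow> 'a) \<Rightarrow> var \<Rightarrow> 'a mat" where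
  "Seval n a b r v = (case v of Yv i \<Rightarrow> Smat n (a i) (b i) (r i) | Zv _ \<Rightarrow> 0\<^sub>m n n)"

lemma Seval_Yv: "Seval n a b r (Yv i) = Smat n (a i) (b i) (r i)"
  by (simp add: Seval_def)

lemma Seval_triv_graded_eval: "2 \<le> n \<Longrightarrow> triv_graded_eval (N_alg n) n (Seval n a b r)"
  by (simp add: triv_graded_eval_def Seval_def Smat_N_alg)

lemma Seval_carrier: "\<forall>v. Seval n a b r v \<in> carrier_mat n n"
  by (simp add: Seval_def split: var.splits)

lemma ncevalm_yword: "ncevalm n (Seval n a b r) (yword u) = mat_word n (Seval n a b r) (map Yv u)"
  using mat_word_carrier[OF Seval_carrier, of n a b r "map Yv u"]
  by (intro eq_matI) (auto simp: yword_def ncevalm_mon[OF Seval_carrier])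

lemma ncevalm_yword_single: "ncevalm n (Seval n a b r) (yword [i]) = Smat n (a i) (b i) (r i)"
  using ncevalm_ncvar[OF Seval_carrier, of n a b r "Yv i"] by (simp add: ncvar_Yv Seval_Yv)

lemma ncevalm_ycomm:
  fixes a b r :: "nat \<Rightarrow> 'a::field"
  shows "ncevalm n (Seval n a b r) (ycomm i j s) =
    Emat n ((r i * b j - r j * b i) * (\<Prod>l\<leftarrow>s. b l)) (length s + 2)"
proof (induction s rule: rev_induct)
  case Nil
  then show ?case
    by (simp add: ycomm_Nil ncevalm_nccomm[OF Seval_carrier] ncevalm_yword_single Smat_commutator numeral_2_eq_2)
next
  case (snoc l s)
  then show ?case
    by (simp add: ycomm_snoc ncevalm_diff ncevalm_mult[OF Seval_carrier] ncevalm_yword_single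
        Emat_Smat_commutator mult.assoc)
qed

lemma mat_word_mult_Emat:
  fixes a b r :: "nat \<Rightarrow> 'a::field"
  shows "mat_word n (Seval n a b r) (map Yv u) * Emat n x d = Emat n ((\<Prod>l\<leftarrow>u. a l) * x) d"
proof (induction u)
  case Nil
  then show ?case by (simp add: mat_word_Nil)
next
  case (Cons l u)
  have "mat_word n (Seval n a b r) (map Yv (l # u)) * Emat n x d =
      Smat n (a l) (b l) (r l) * (mat_word n (Seval n a b r) (map Yv u) * Emat n x d)"
    using mat_word_carrier[OF Seval_carrier, of n a b r "map Yv u"]
    by (simp add: mat_word_Cons Seval_Yv assoc_mult_mat[of _ n n _ n _ n])
  then show ?case by (simp add: Cons.IH Smat_mult_Emat mult.assoc)
qed

text \<open>\<kappa> lists the coefficients of the monomial functions a^\<alpha> r_i b^\<beta>.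
  Adding up the columns loses nothing, because the column of a term is already visible as size
  \<beta> + 1; terms from the ideal vanish in all these columns.\<close>

lemma comm_expansion_eval:
  fixes p :: "'a::field ncpoly"
  assumes "3 \<le> k" "2 \<le> n" "k \<le> Suc n" "comm_expansion k p \<kappa>"
  shows "(\<Sum>l\<in>{1..k - 2}. ncevalm n (Seval n a b r) p $$ (0, l)) =
    (\<Sum>t\<in>Poly_Mapping.keys \<kappa>. Poly_Mapping.lookup \<kappa> t *
      (case t of (\<alpha>, i, \<beta>) \<Rightarrow> (\<Prod>v\<in>#\<alpha>. a v) * r i * (\<Prod>v\<in>#\<beta>. b v)))"
  using assms(4)
proof (induction rule: comm_expansion.induct)
  case (ideal p)
  have "ncevalm n (Seval n a b r) p \<in> row_ideal n (k - 2)"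
    by (rule T2_ideal_N_gens_eval[OF assms(1,2) ideal Seval_triv_graded_eval[OF assms(2)]])
  then show ?case using assms by (auto intro!: sum.neutral row_idealD)
next
  case (add p \<kappa> q \<mu>)
  have "(\<Sum>l\<in>{1..k - 2}. ncevalm n (Seval n a b r) (p + q) $$ (0, l)) =
      (\<Sum>l\<in>{1..k - 2}. ncevalm n (Seval n a b r) p $$ (0, l)) +
      (\<Sum>l\<in>{1..k - 2}. ncevalm n (Seval n a b r) q $$ (0, l))"
    unfolding sum.distrib[symmetric] by (rule sum.cong) (use assms in \<open>auto simp: ncevalm_add\<close>)
  moreover have "(\<Sum>t\<in>Poly_Mapping.keys (\<kappa> + \<mu>). Poly_Mapping.lookup (\<kappa> + \<mu>) t *
      (case t of (\<alpha>, i, \<beta>) \<Rightarrow> (\<Prod>v\<in>#\<alpha>. a v) * r i * (\<Prod>v\<in>#\<beta>. b v))) =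
    (\<Sum>t\<in>Poly_Mapping.keys \<kappa>. Poly_Mapping.lookup \<kappa> t *
      (case t of (\<alpha>, i, \<beta>) \<Rightarrow> (\<Prod>v\<in>#\<alpha>. a v) * r i * (\<Prod>v\<in>#\<beta>. b v))) +
    (\<Sum>t\<in>Poly_Mapping.keys \<mu>. Poly_Mapping.lookup \<mu> t *
      (case t of (\<alpha>, i, \<beta>) \<Rightarrow> (\<Prod>v\<in>#\<alpha>. a v) * r i * (\<Prod>v\<in>#\<beta>. b v)))"
    by (rule sum_keys_add) (simp_all add: distrib_right)
  ultimately show ?case using add.IH by simp
next
  case (comm s c u i j)
  let ?x = "(\<Prod>l\<leftarrow>u. a l) * ((r i * b j - r j * b i) * (\<Prod>l\<leftarrow>s. b l))"
  have "ncevalm n (Seval n a b r) (mon [] c * (yword u * ycomm i j s)) = c \<cdot>\<^sub>m Emat n ?x (length s + 2)"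
    unfolding ncevalm_scalar[OF Seval_carrier]
    by (simp add: ncevalm_mult[OF Seval_carrier] ncevalm_yword ncevalm_ycomm
        mat_word_mult_Emat)
  then have "(\<Sum>l\<in>{1..k - 2}. ncevalm n (Seval n a b r) (mon [] c * (yword u * ycomm i j s)) $$ (0, l)) =
      (\<Sum>l\<in>{1..k - 2}. if l = length s + 2 then c * ?x else 0)"
    by (intro sum.cong) (use assms in \<open>auto simp: Emat_index\<close>)
  \<comment> \<open>The bound \<open>length s + 4 \<le> k\<close> places column length s + 2 inside
    the range of summation.\<close>
  also have "\<dots> = c * ?x" using comm by auto
  finally have lhs: "(\<Sum>l\<in>{1..k - 2}. ncevalm n (Seval n a b r) (mon [] c * (yword u * ycomm i j s)) $$ (0, l)) =
      c * ?x" .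
  let ?t = "(mset u, i, add_mset j (mset s))" and ?t' = "(mset u, j, add_mset i (mset s))"
  let ?\<kappa> = "mon ?t c + mon ?t' (- c)"
  let ?\<chi> = "\<lambda>(\<alpha>, i, \<beta>). (\<Prod>v\<in>#\<alpha>. a v) * r i * (\<Prod>v\<in>#\<beta>. b v)"
  have "(\<Sum>t\<in>Poly_Mapping.keys ?\<kappa>. Poly_Mapping.lookup ?\<kappa> t * ?\<chi> t) =
      (\<Sum>t\<in>Poly_Mapping.keys (mon ?t c). Poly_Mapping.lookup (mon ?t c) t * ?\<chi> t) +
      (\<Sum>t\<in>Poly_Mapping.keys (mon ?t' (- c)). Poly_Mapping.lookup (mon ?t' (- c)) t * ?\<chi> t)"
    by (rule sum_keys_add) (simp_all add: distrib_right)
  also have "\<dots> = c * ?\<chi> ?t - c * ?\<chi> ?t'" by simp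
  also have "\<dots> = c * ?x"
    by (simp add: prod_mset_prod_list algebra_simps flip: mset_map)
  finally have "(\<Sum>t\<in>Poly_Mapping.keys ?\<kappa>. Poly_Mapping.lookup ?\<kappa> t * ?\<chi> t) = c * ?x" .
  moreover have "?\<kappa> = mon ?t c - mon ?t' c" by (simp add: single_uminus)
  ultimately show ?case using lhs by (simp only:)
qed

text \<open>The common core of both equalities, applied with n = k - 1 and n = k. The monomial
  functions are distinct characters of the triples (a, b, r) under pointwise multiplication, so
  \<kappa> = 0.\<close>

lemma T2_ideal_N_gensI:
  fixes p :: "'a::field_char_0 ncpoly"
  assumes "3 \<le> k" "2 \<le> n" "k \<le> Suc n"
    and "\<And>\<alpha>. (\<Sum>w\<in>{w \<in> {w \<in> Poly_Mapping.keys p. set w \<subseteq> range Yv}. mset w = \<alpha>}. Poly_Mapping.lookup p w) = 0"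
    and "\<And>\<phi> l. triv_graded_eval (N_alg n) n \<phi> \<Longrightarrow> l \<in> {1..k - 2} \<Longrightarrow> ncevalm n \<phi> p $$ (0, l) = 0"
  shows "p \<in> T2_ideal (N_gens k)"
proof -
  obtain \<kappa> where \<kappa>: "comm_expansion k p \<kappa>"
    using expandable_abelianization_zero[OF assms(1,4)] by (auto simp: expandable_def)
  let ?\<chi> = "\<lambda>(\<alpha>, i, \<beta>) (a, b, r). (\<Prod>v\<in>#\<alpha>. a v) * r i * (\<Prod>v\<in>#\<beta>. b v) :: 'a"
  have "Poly_Mapping.lookup \<kappa> t = 0" if "t \<in> Poly_Mapping.keys \<kappa>" for t
  proof (rule characters_independent[of "Poly_Mapping.keys \<kappa>" ?\<chi>
        "\<lambda>(a, b, r) (a', b', r'). (\<lambda>v. a v * a' v, \<lambda>v. b v * b' v, \<lambda>v. r v * r' v)"])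
    fix x :: "(nat \<Rightarrow> 'a) \<times> (nat \<Rightarrow> 'a) \<times> (nat \<Rightarrow> 'a)"
    obtain a b r where x: "x = (a, b, r)" by (cases x)
    have "(\<Sum>l\<in>{1..k - 2}. ncevalm n (Seval n a b r) p $$ (0, l)) = 0"
      using assms(5) Seval_triv_graded_eval[OF assms(2)] by (intro sum.neutral) blast
    then show "(\<Sum>t\<in>Poly_Mapping.keys \<kappa>. Poly_Mapping.lookup \<kappa> t * ?\<chi> t x) = 0"
      using comm_expansion_eval[OF assms(1-3) \<kappa>, of a b r] by (simp add: x case_prod_beta)
  next
    fix t :: "nat multiset \<times> nat \<times> nat multiset"
    show "\<exists>x. ?\<chi> t x \<noteq> 0"
      by (rule exI[of _ "(\<lambda>_. 1, \<lambda>_. 1, \<lambda>_. 1)"]) (simp split: prod.splits)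
  next
    fix s t :: "nat multiset \<times> nat \<times> nat multiset" assume "s \<noteq> t"
    obtain \<alpha> i \<beta> where s: "s = (\<alpha>, i, \<beta>)" by (cases s)
    obtain \<alpha>' i' \<beta>' where t: "t = (\<alpha>', i', \<beta>')" by (cases t)
    consider "\<alpha> \<noteq> \<alpha>'" | "\<beta> \<noteq> \<beta>'" | "i \<noteq> i'" using \<open>s \<noteq> t\<close> s t by auto
    then show "\<exists>x. ?\<chi> s x \<noteq> ?\<chi> t x"
    proof cases
      case 1
      then obtain a :: "nat \<Rightarrow> 'a" where "(\<Prod>v\<in>#\<alpha>. a v) \<noteq> (\<Prod>v\<in>#\<alpha>'. a v)"
        using prod_mset_separates by blast
      then show ?thesis by (intro exI[of _ "(a, \<lambda>_. 1, \<lambda>_. 1)"]) (simp add: s t)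
    next
      case 2
      then obtain b :: "nat \<Rightarrow> 'a" where "(\<Prod>v\<in>#\<beta>. b v) \<noteq> (\<Prod>v\<in>#\<beta>'. b v)"
        using prod_mset_separates by blast
      then show ?thesis by (intro exI[of _ "(\<lambda>_. 1, b, \<lambda>_. 1)"]) (simp add: s t)
    next
      case 3
      then show ?thesis
        \<comment> \<open>The indicator of i as \<open>r\<close> gives the value 1 on s and 0 on
          t.\<close>
        by (intro exI[of _ "(\<lambda>_. 1, \<lambda>_. 1, \<lambda>v. if v = i then 1 else 0)"]) (simp add: s t)
    qed
  qed (use that in \<open>auto simp: prod_mset_mult\<close>)
  then have "\<kappa> = 0" by (metis in_keys_iff keys_eq_empty equals0I)
  then show ?thesis
    using T2_ideal_uminus[OF comm_expansion_koszul_homotopy[OF \<kappa>]] by simp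
qed

section \<open>Matrix entries that detect the commutative image\<close>

lemma mat_word_Seval_index:
  fixes a b r :: "nat \<Rightarrow> 'a::field"
  assumes "i < n"
  shows mat_word_Seval_lower: "j < i \<Longrightarrow> mat_word n (Seval n a b r) (map Yv u) $$ (i, j) = 0"
    and mat_word_Seval_diag: "mat_word n (Seval n a b r) (map Yv u) $$ (i, i) = (\<Prod>l\<leftarrow>u. a l)"
  using assms
proof (induction u arbitrary: i j)
  case Nil
  { case 1 then show ?case by (simp add: mat_word_Nil) }
  { case 2 then show ?case by (simp add: mat_word_Nil) }
next
  case (Cons l u)
  note c = mat_word_carrier[OF Seval_carrier, of n a b r "map Yv u"]
  { case 1
    then show ?case
      using Cons.IH by (simp add: mat_word_Cons Seval_Yv Smat_mult_index[OF c] del: index_mult_mat(1)) }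
  { case 2
    then show ?case
      using Cons.IH by (simp add: mat_word_Cons Seval_Yv Smat_mult_index[OF c] del: index_mult_mat(1)) }
qed

text \<open>With a = b = r every letter is evaluated at a_l (I + E), and (I + E)^m has the entry m
  just above the diagonal.\<close>

lemma mat_word_Seval_12:
  fixes a :: "nat \<Rightarrow> 'a::field"
  assumes "3 \<le> n"
  shows "mat_word n (Seval n a a a) (map Yv u) $$ (1, 2) = of_nat (length u) * (\<Prod>l\<leftarrow>u. a l)"
proof (induction u)
  case Nil
  then show ?case using assms by (simp add: mat_word_Nil)
next
  case (Cons l u)
  note c = mat_word_carrier[OF Seval_carrier, of n a a a "map Yv u"]
  have "mat_word n (Seval n a a a) (map Yv u) $$ (2, 2) = (\<Prod>l\<leftarrow>u. a l)"
    using assms by (intro mat_word_Seval_diag) auto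
  then show ?case
    using assms Cons.IH Smat_mult_index[OF c, of 1 2 "a l" "a l" "a l"]
    by (simp add: mat_word_Cons Seval_Yv numeral_2_eq_2 algebra_simps del: index_mult_mat(1))
qed

lemma ncevalm_Yv_words:
  assumes "triv_graded_eval (N_alg n) n \<phi>" "i < n" "j < n"
  shows "ncevalm n \<phi> p $$ (i, j) = (\<Sum>w\<in>{w \<in> Poly_Mapping.keys p. set w \<subseteq> range Yv}.
    Poly_Mapping.lookup p w * mat_word n \<phi> w $$ (i, j))"
  unfolding ncevalm_index[OF assms(2,3)]
proof (rule sum.mono_neutral_right)
  show "\<forall>w\<in>Poly_Mapping.keys p - {w \<in> Poly_Mapping.keys p. set w \<subseteq> range Yv}.
    Poly_Mapping.lookup p w * mat_word n \<phi> w $$ (i, j) = 0"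
  proof
    fix w assume "w \<in> Poly_Mapping.keys p - {w \<in> Poly_Mapping.keys p. set w \<subseteq> range Yv}"
    then obtain v where v: "v \<in> set w" "v \<notin> range Yv" by auto
    then obtain l where "v = Zv l" by (metis rangeI var.exhaust)
    then show "Poly_Mapping.lookup p w * mat_word n \<phi> w $$ (i, j) = 0"
      using mat_word_Zv[OF assms(1)] v assms(2,3) by auto
  qed
qed auto

lemma Yv_word_map:
  assumes "set w \<subseteq> range Yv"
  obtains u where "w = map Yv u"
  using assms by (metis ex_map_conv subsetD rangeE)

lemma ncevalm_Seval_00:
  fixes a :: "var \<Rightarrow> 'a::field"
  assumes "2 \<le> n"
  shows "ncevalm n (Seval n (\<lambda>i. a (Yv i)) b r) p $$ (0, 0) =
    (\<Sum>w\<in>{w \<in> Poly_Mapping.keys p. set w \<subseteq> range Yv}. Poly_Mapping.lookup p w * (\<Prod>v\<leftarrow>w. a v))"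
proof -
  have "mat_word n (Seval n (\<lambda>i. a (Yv i)) b r) w $$ (0, 0) = (\<Prod>v\<leftarrow>w. a v)" if w: "set w \<subseteq> range Yv" for w
  proof -
    obtain u where u: "w = map Yv u" using w by (rule Yv_word_map)
    have "mat_word n (Seval n (\<lambda>i. a (Yv i)) b r) (map Yv u) $$ (0, 0) = (\<Prod>i\<leftarrow>u. a (Yv i))"
      by (rule mat_word_Seval_diag) (use assms in simp)
    then show ?thesis by (simp add: u o_def)
  qed
  then show ?thesis
    using assms by (subst ncevalm_Yv_words[OF Seval_triv_graded_eval]) auto
qed

lemma ncevalm_Seval_12:
  fixes a :: "var \<Rightarrow> 'a::field"
  assumes "3 \<le> n"
  shows "ncevalm n (Seval n (\<lambda>i. a (Yv i)) (\<lambda>i. a (Yv i)) (\<lambda>i. a (Yv i))) p $$ (1, 2) =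
    (\<Sum>w\<in>{w \<in> Poly_Mapping.keys p. set w \<subseteq> range Yv}.
      Poly_Mapping.lookup p w * of_nat (length w) * (\<Prod>v\<leftarrow>w. a v))"
proof -
  let ?\<phi> = "Seval n (\<lambda>i. a (Yv i)) (\<lambda>i. a (Yv i)) (\<lambda>i. a (Yv i))"
  have "mat_word n ?\<phi> w $$ (1, 2) = of_nat (length w) * (\<Prod>v\<leftarrow>w. a v)" if w: "set w \<subseteq> range Yv" for w
  proof -
    obtain u where u: "w = map Yv u" using w by (rule Yv_word_map)
    show ?thesis unfolding u mat_word_Seval_12[OF assms] by (simp add: o_def)
  qed
  then show ?thesis
    using assms by (subst ncevalm_Yv_words[OF Seval_triv_graded_eval]) (auto simp: mult.assoc)
qed

subsection \<open>Identities and central polynomials\<close>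

lemma Id_gr_N_alg:
  assumes "3 \<le> k"
  shows "Id_gr (N_alg (k - 1) :: 'a::field_char_0 mat set) (k - 1) = T2_ideal (N_gens k)"
proof (intro equalityI subsetI)
  let ?n = "k - 1"
  fix p :: "'a ncpoly" assume p: "p \<in> Id_gr (N_alg ?n) ?n"
  show "p \<in> T2_ideal (N_gens k)"
  proof (rule T2_ideal_N_gensI[of k ?n])
    fix \<alpha>
    show "(\<Sum>w\<in>{w \<in> {w \<in> Poly_Mapping.keys p. set w \<subseteq> range Yv}. mset w = \<alpha>}. Poly_Mapping.lookup p w) = 0"
    proof (rule sum_words_vanish_imp_abelianization_zero)
      fix a :: "var \<Rightarrow> 'a"
      \<comment> \<open>A scalar evaluation: its corner entry is the commutative image of p at
        a.\<close>
      have "triv_graded_eval (N_alg ?n) ?n (Seval ?n (\<lambda>i. a (Yv i)) (\<lambda>_. 0) (\<lambda>_. 0))"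
        using assms by (intro Seval_triv_graded_eval) auto
      then have "ncevalm ?n (Seval ?n (\<lambda>i. a (Yv i)) (\<lambda>_. 0) (\<lambda>_. 0)) p $$ (0, 0) = 0"
        using p assms by (simp add: Id_gr_def)
      then show "(\<Sum>w\<in>{w \<in> Poly_Mapping.keys p. set w \<subseteq> range Yv}. Poly_Mapping.lookup p w * (\<Prod>v\<leftarrow>w. a v)) = 0"
        using assms by (subst (asm) ncevalm_Seval_00) auto
    qed simp
  qed (use p assms in \<open>auto simp: Id_gr_def\<close>)
next
  let ?n = "k - 1"
  fix p :: "'a ncpoly" assume p: "p \<in> T2_ideal (N_gens k)"
  have "ncevalm ?n \<phi> p = 0\<^sub>m ?n ?n" if \<phi>: "triv_graded_eval (N_alg ?n) ?n \<phi>" for \<phi>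
  proof -
    have "ncevalm ?n \<phi> p \<in> row_ideal ?n (k - 2)"
      by (rule T2_ideal_N_gens_eval[OF assms _ p \<phi>]) (use assms in simp)
    \<comment> \<open>For n = k - 1 the columns up to k - 2 are all columns.\<close>
    then show ?thesis by (intro eq_matI) (auto intro: row_idealD)
  qed
  then show "p \<in> Id_gr (N_alg ?n) ?n" by (simp add: Id_gr_def)
qed

lemma center_N_alg_index:
  fixes A :: "'a::field mat"
  assumes "3 \<le> k" "A \<in> center_of (N_alg k)"
  shows "A $$ (1, 2) = 0" and "l \<in> {1..k - 2} \<Longrightarrow> A $$ (0, l) = 0"
proof -
  have A: "A \<in> carrier_mat k k" using assms(2) by (auto simp: center_of_def intro: N_alg_carrier)
  have comm: "A * Smat k a b r = Smat k a b r * A" for a b r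
    using assms Smat_N_alg[of k a b r] by (auto simp: center_of_def)
  \<comment> \<open>This matrix is e_{12}: left multiplication by it moves the second row of A into
    the first, while right multiplication contributes nothing to column 2.\<close>
  have "(A * Smat k 0 0 1) $$ (0, 2) = (Smat k 0 0 1 * A) $$ (0, 2)" by (simp only: comm)
  then show "A $$ (1, 2) = 0"
    using assms(1) by (simp add: Smat_mult_index[OF A] mult_Smat_index[OF A] del: index_mult_mat(1))
  assume l: "l \<in> {1..k - 2}"
  \<comment> \<open>This matrix is E - e_{12}: right multiplication shifts the first row of A by one
    column for l \<ge> 1, and left multiplication gives a zero first row.\<close>
  have "(A * Smat k 0 1 0) $$ (0, Suc l) = A $$ (0, l)"
    using mult_Smat_index[OF A, of 0 "Suc l" 0 1 0] assms(1) l by auto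
  moreover have "(Smat k 0 1 0 * A) $$ (0, Suc l) = 0"
    using Smat_mult_index[OF A, of 0 "Suc l" 0 1 0] assms(1) l by auto
  ultimately show "A $$ (0, l) = 0" by (simp only: comm)
qed

text \<open>One more bracket moves into \<open>row_ideal k (k - 1)\<close>, which is zero.\<close>

lemma row_ideal_center:
  assumes "3 \<le> k" "M \<in> row_ideal k (k - 2)" "M \<in> N_alg k"
  shows "M \<in> center_of (N_alg k)"
proof -
  have "M * B = B * M" if B: "B \<in> N_alg k" for B
  proof -
    have I: "M * B - B * M \<in> row_ideal k (Suc (k - 2))"
      by (rule commutator_row_ideal_Suc) (use assms B in auto)
    have c: "M \<in> carrier_mat k k" "B \<in> carrier_mat k k"
      using assms(3) B N_alg_carrier by auto
    show ?thesis
    proof (rule eq_matI)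
      fix i j assume "i < dim_row (B * M)" "j < dim_col (B * M)"
      then have ij: "i < k" "j < k" using c by auto
      then have "(M * B - B * M) $$ (i, j) = 0" by (intro row_idealD[OF I]) (use assms(1) in auto)
      then show "(M * B) $$ (i, j) = (B * M) $$ (i, j)" using ij c by (simp del: index_mult_mat(1))
    qed (use c in auto)
  qed
  then show ?thesis using assms(3) by (simp add: center_of_def)
qed

lemma C_gr_N_alg:
  assumes "3 \<le> k"
  shows "C_gr (N_alg k :: 'a::field_char_0 mat set) k = T2_ideal (N_gens k)"
proof (intro equalityI subsetI)
  fix p :: "'a ncpoly" assume p: "p \<in> C_gr (N_alg k) k"
  let ?K = "{w \<in> Poly_Mapping.keys p. set w \<subseteq> range Yv}"
  have center: "ncevalm k \<phi> p \<in> center_of (N_alg k)" if "triv_graded_eval (N_alg k) k \<phi>" for \<phi>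
    using p that by (simp add: C_gr_def)
  show "p \<in> T2_ideal (N_gens k)"
  proof (rule T2_ideal_N_gensI[of k k])
    fix \<alpha>
    \<comment> \<open>Scalar matrices are central, so the diagonal says nothing about p. The entry
      (1, 2) vanishes on the center and yields the commutative image weighted by word
      length.\<close>
    have "(\<Sum>w\<in>{w \<in> ?K. mset w = \<alpha>}. Poly_Mapping.lookup p w * of_nat (length w)) = 0"
    proof (rule sum_words_vanish_imp_abelianization_zero)
      fix a :: "var \<Rightarrow> 'a"
      have "triv_graded_eval (N_alg k) k (Seval k (\<lambda>i. a (Yv i)) (\<lambda>i. a (Yv i)) (\<lambda>i. a (Yv i)))"
        using assms by (intro Seval_triv_graded_eval) auto
      from center_N_alg_index(1)[OF assms center[OF this]]
      show "(\<Sum>w\<in>?K. Poly_Mapping.lookup p w * of_nat (length w) * (\<Prod>v\<leftarrow>w. a v)) = 0"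
        by (simp only: ncevalm_Seval_12[OF assms])
    qed simp
    moreover have "(\<Sum>w\<in>{w \<in> ?K. mset w = \<alpha>}. Poly_Mapping.lookup p w * of_nat (length w)) =
        (\<Sum>w\<in>{w \<in> ?K. mset w = \<alpha>}. Poly_Mapping.lookup p w) * of_nat (size \<alpha>)"
      unfolding sum_distrib_right by (rule sum.cong) auto
    ultimately have "(\<Sum>w\<in>{w \<in> ?K. mset w = \<alpha>}. Poly_Mapping.lookup p w) * of_nat (size \<alpha>) = 0"
      by (simp only:)
    then have "size \<alpha> = 0 \<or> (\<Sum>w\<in>{w \<in> ?K. mset w = \<alpha>}. Poly_Mapping.lookup p w) = 0"
      by (simp only: mult_eq_0_iff of_nat_eq_0_iff disj_commute)
    then show "(\<Sum>w\<in>{w \<in> ?K. mset w = \<alpha>}. Poly_Mapping.lookup p w) = 0"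
    proof
      \<comment> \<open>The weight is zero only for the empty word, where the zero constant term of
        a central polynomial is used.\<close>
      assume "size \<alpha> = 0"
      then show ?thesis using p by (intro sum.neutral) (auto simp: C_gr_def)
    qed
  qed (use assms center_N_alg_index(2)[OF assms center] in auto)
next
  fix p :: "'a ncpoly" assume p: "p \<in> T2_ideal (N_gens k)"
  have I: "ncevalm k \<phi> p \<in> row_ideal k (k - 2)" if "triv_graded_eval (N_alg k) k \<phi>" for \<phi>
    by (rule T2_ideal_N_gens_eval[OF assms _ p that]) (use assms in simp)
  have "ncevalm k \<phi> p \<in> center_of (N_alg k)" if \<phi>: "triv_graded_eval (N_alg k) k \<phi>" for \<phi>
    using row_ideal_center[OF assms I[OF \<phi>]] ncevalm_N_alg[OF _ \<phi>] assms by simp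
  moreover have "Poly_Mapping.lookup p [] = 0"
  proof -
    let ?K = "{w \<in> Poly_Mapping.keys p. set w \<subseteq> range Yv}"
    \<comment> \<open>Evaluating every variable at 0 leaves the constant term in the corner, an
      entry that is zero throughout \<open>row_ideal\<close>.\<close>
    have "triv_graded_eval (N_alg k) k (Seval k (\<lambda>_. 0) (\<lambda>_. 0) (\<lambda>_. 0 :: 'a))"
      using assms by (intro Seval_triv_graded_eval) auto
    from row_idealD[OF I[OF this], of 0 0]
    have "0 = (\<Sum>w\<in>?K. Poly_Mapping.lookup p w * (\<Prod>v\<leftarrow>w. 0))"
      using assms ncevalm_Seval_00[of k "\<lambda>_. 0" "\<lambda>_. 0" "\<lambda>_. 0" p] by simp
    also have "\<dots> = (\<Sum>w\<in>?K. if w = [] then Poly_Mapping.lookup p [] else 0)"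
      by (rule sum.cong) (auto simp: prod_list_zero_iff neq_Nil_conv)
    finally show ?thesis by (auto simp: in_keys_iff split: if_splits)
  qed
  ultimately show "p \<in> C_gr (N_alg k) k" by (simp add: C_gr_def)
qed

theorem theorem3p3:
  fixes k :: nat
  assumes "k \<ge> 3"
  shows "C_gr (N_alg k :: 'a::field_char_0 mat set) k = Id_gr (N_alg (k - 1) :: 'a mat set) (k - 1)
    \<and> Id_gr (N_alg (k - 1) :: 'a mat set) (k - 1) =
      T2_ideal {nccomms (ncvar (Yv 1)) (map (\<lambda>i. ncvar (Yv i)) [2..<k]),
                ncmul (nccomm (ncvar (Yv 1)) (ncvar (Yv 2))) (nccomm (ncvar (Yv 3)) (ncvar (Yv 4))),
                ncvar (Zv 1)}"
  unfolding N_gens_def[symmetric] 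
  using C_gr_N_alg[OF assms, where ?'a = 'a] Id_gr_N_alg[OF assms, where ?'a = 'a] by simp

end
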